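(* Consider the fixed-final-time problem described in the context, for an initial location $\mathbf{x}_0$ and final time $T$ for which the Evader's optimal trajectory activates the constraint: it travels in a straight line to the Proximity Circle at angle $\theta_{\tan}$ at time $t_{\tan}$, rides along the Proximity Circle, and leaves it at some angle $\theta_{\rm exit}$. For $\theta$ on the circle let $t_{\rm r}(\theta)=T-t_{\tan}-t_{\rm arc}(\theta_{\tan},\theta)$ be the remaining time and $\psi(\theta)=\operatorname{atan}(\sin\theta,\ \cos\theta-t_{\rm r}(\theta))$. Then the optimal exit angle $\theta_{\rm exit}$ satisfies $$\operatorname{atan}\big(\mu\sin\psi_{\rm exit},\ \mu\cos\psi_{\rm exit}-1\big)-\theta_{\rm exit}=\tfrac{\pi}{2},$$ where $\psi_{\rm exit}=\psi(\theta_{\rm exit})$; that is, at the optimal exit angle the optimal unconstrained straight-line trajectory is tangent to the Proximity Circle.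
   Context: Pursuer-fixed frame: the Evader's relative position $\mathbf{x}(t)=(x(t),y(t))\in\mathbb{R}^2$ evolves as $\dot x=\mu\cos\psi(t)-1$, $\dot y=\mu\sin\psi(t)$, $\mathbf{x}(0)=\mathbf{x}_0=(x_0,y_0)$, $\|\mathbf{x}_0\|>1$, $\mu\in(0,1)$, $\psi(t)$ the Evader's heading. For fixed $T$ the Evader maximizes $\|\mathbf{x}(T)\|^2$ subject to $\|\mathbf{x}(t)\|\ge1$ on $[0,T]$ (Proximity Circle $\|\mathbf{x}\|=1$; angle $\theta$ on it means the point $(\cos\theta,\sin\theta)$). Define $\phi_{\tan}=\pi-\sin^{-1}(1/\|\mathbf{x}_0\|)+\operatorname{atan}(y_0,x_0)$, $\theta_{\tan}=\cos^{-1}(1/\|\mathbf{x}_0\|)+\operatorname{atan}(y_0,x_0)$ and $t_{\tan}=\sqrt{\|\mathbf{x}_0\|^2-1}\big/\big(-\cos\phi_{\tan}+\sqrt{\mu^2-\sin^2\phi_{\tan}}\big)$. The time spent riding the circle from angle $\theta_1$ to $\theta_2$ is $t_{\rm arc}(\theta_1,\theta_2)=\frac{\cos\theta_1-\cos\theta_2}{1-\mu^2}-\frac{\mu}{1-\mu^2}\int_{\theta_1}^{\theta_2}\sqrt{1-\cos^2\theta/\mu^2}\,d\theta$. $\operatorname{atan}(a,b)$ is the two-argument arctangent (polar angle of $(b,a)$). The paper assumes $y\ge0$ throughout. *)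

theory Defs
  imports "HOL-Analysis.Analysis"
begin

definition atan2 :: "real \<Rightarrow> real \<Rightarrow> real" where
  "atan2 a b = Arg (Complex b a)"

text \<open>Relative velocity of the Evader in the Pursuer-fixed frame for heading psi.\<close>
definition vel :: "real \<Rightarrow> real \<Rightarrow> real \<times> real" where
  "vel mu p = (mu * cos p - 1, mu * sin p)"

definition traj :: "real \<Rightarrow> real \<times> real \<Rightarrow> (real \<Rightarrow> real) \<Rightarrow> real \<Rightarrow> real \<times> real" where
  "traj mu x0 psi t = x0 + integral {0..t} (\<lambda>s. vel mu (psi s))"

text \<open>Admissible heading (measurable, i.e. velocity integrable) respecting the Proximity Circle on [0,T].\<close>
definition admissible :: "real \<Rightarrow> real \<times> real \<Rightarrow> real \<Rightarrow> (real \<Rightarrow> real) \<Rightarrow> bool" where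
  "admissible mu x0 T psi \<longleftrightarrow>
     (\<lambda>s. vel mu (psi s)) integrable_on {0..T} \<and>
     (\<forall>t\<in>{0..T}. norm (traj mu x0 psi t) \<ge> 1)"

definition optimal :: "real \<Rightarrow> real \<times> real \<Rightarrow> real \<Rightarrow> (real \<Rightarrow> real) \<Rightarrow> bool" where
  "optimal mu x0 T psi \<longleftrightarrow> admissible mu x0 T psi \<and>
     (\<forall>psi'. admissible mu x0 T psi' \<longrightarrow>
        (norm (traj mu x0 psi' T))\<^sup>2 \<le> (norm (traj mu x0 psi T))\<^sup>2)"

definition phi_tan :: "real \<times> real \<Rightarrow> real" where
  "phi_tan x0 = pi - arcsin (1 / norm x0) + atan2 (snd x0) (fst x0)"

definition theta_tan :: "real \<times> real \<Rightarrow> real" where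
  "theta_tan x0 = arccos (1 / norm x0) + atan2 (snd x0) (fst x0)"

definition t_tan :: "real \<Rightarrow> real \<times> real \<Rightarrow> real" where
  "t_tan mu x0 = sqrt ((norm x0)\<^sup>2 - 1) /
      (- cos (phi_tan x0) + sqrt (mu\<^sup>2 - (sin (phi_tan x0))\<^sup>2))"

definition oint :: "(real \<Rightarrow> real) \<Rightarrow> real \<Rightarrow> real \<Rightarrow> real" where
  "oint f a b = (if a \<le> b then integral {a..b} f else - integral {b..a} f)"

definition t_arc :: "real \<Rightarrow> real \<Rightarrow> real \<Rightarrow> real" where
  "t_arc mu th1 th2 = (cos th1 - cos th2) / (1 - mu\<^sup>2)
     - mu / (1 - mu\<^sup>2) * oint (\<lambda>th. sqrt (1 - (cos th)\<^sup>2 / mu\<^sup>2)) th1 th2"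

definition t_r :: "real \<Rightarrow> real \<times> real \<Rightarrow> real \<Rightarrow> real \<Rightarrow> real" where
  "t_r mu x0 T th = T - t_tan mu x0 - t_arc mu (theta_tan x0) th"

definition psi_of :: "real \<Rightarrow> real \<times> real \<Rightarrow> real \<Rightarrow> real \<Rightarrow> real" where
  "psi_of mu x0 T th = atan2 (sin th) (cos th - t_r mu x0 T th)"

end

theory Submission
  imports Defs
begin

text \<open>Let u be the unit vector pointing to the final position. Replacing the heading on a short
  interval by u increases the u-component of the final position, so whenever such a replacement is
  admissible the heading already was u. Hence the Evader leaves the circle on a straight line with
  velocity w = mu u - (1,0). If w pointed strictly outwards at the exit point, starting this straight
  line a little earlier would be admissible as well, although the earlier trajectory runs on the circle;
  so w is tangent to the circle.

  It remains to see that the angle psi formed with the nominal remaining time is the direction of u.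
  Tangentially the Evader cannot beat the faster of the two speeds with which the circle can be
  ridden, so the ride takes at least the time given by the arc formula; if it took longer, riding at
  full speed and spending the saved time in direction u would increase the final distance.\<close>

section \<open>Trajectories and switching of headings\<close>

definition switch :: "real \<Rightarrow> (real \<Rightarrow> 'a) \<Rightarrow> (real \<Rightarrow> 'a) \<Rightarrow> real \<Rightarrow> 'a" where
  "switch a p q = (\<lambda>s. if s \<le> a then p s else q s)"

lemma vel_eq: "vel mu p = mu *\<^sub>R (cos p, sin p) - (1, 0)"
  by (simp add: vel_def)

lemma norm_cos_sin [simp]: "norm (cos p :: real, sin p) = 1"
  by (simp add: norm_Pair)

lemma unit_vector_angle:
  fixes v :: "real \<times> real"
  assumes "norm v = 1"
  obtains p where "v = (cos p, sin p)"
proof -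
  have "(fst v)\<^sup>2 + (snd v)\<^sup>2 = 1"
    using assms by (cases v) (simp add: norm_Pair)
  then obtain p where "fst v = cos p" "snd v = sin p"
    using sincos_total_2pi by metis
  then show ?thesis
    using that by (metis prod.collapse)
qed

lemma vel_const_has_integral:
  "a \<le> t \<Longrightarrow> ((\<lambda>s. vel mu p) has_integral ((t - a) *\<^sub>R vel mu p)) {a..t}"
  using has_integral_const_real[of "vel mu p" a t] by simp

lemma traj_switch_before:
  "t \<le> a \<Longrightarrow> traj mu x0 (switch a p q) t = traj mu x0 p t"
  unfolding traj_def switch_def by (auto intro!: integral_cong)

lemma vel_switch_after_has_integral:
  assumes "((\<lambda>s. vel mu (q s)) has_integral v) {a..t}"
  shows "((\<lambda>s. vel mu (switch a p q s)) has_integral v) {a..t}"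
  \<comment> \<open>On \<open>{a..t}\<close> the pasted heading differs from \<open>q\<close> at
    most at the instant \<open>a\<close>, a null set.\<close>
  by (rule has_integral_spike_finite[OF _ _ assms, of "{a}"]) (auto simp: switch_def)

lemma vel_switch_has_integral:
  assumes "0 \<le> a" "a \<le> t" "(\<lambda>s. vel mu (p s)) integrable_on {0..a}"
    and "((\<lambda>s. vel mu (q s)) has_integral v) {a..t}"
  shows "((\<lambda>s. vel mu (switch a p q s)) has_integral
            (integral {0..a} (\<lambda>s. vel mu (p s)) + v)) {0..t}"
proof (rule has_integral_combine[OF assms(1,2)])
  show "((\<lambda>s. vel mu (switch a p q s)) has_integral integral {0..a} (\<lambda>s. vel mu (p s))) {0..a}"
    using integrable_integral[OF assms(3)]
    by (rule has_integral_eq[rotated]) (simp add: switch_def)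
qed (rule vel_switch_after_has_integral[OF assms(4)])

lemma traj_switch_after:
  assumes "0 \<le> a" "a \<le> t" "(\<lambda>s. vel mu (p s)) integrable_on {0..a}"
    and "((\<lambda>s. vel mu (q s)) has_integral v) {a..t}"
  shows "traj mu x0 (switch a p q) t = traj mu x0 p a + v"
  using integral_unique[OF vel_switch_has_integral[OF assms]] by (simp add: traj_def)

lemma traj_increment:
  assumes "(\<lambda>s. vel mu (psi s)) integrable_on {0..T}" "0 \<le> s" "s \<le> t" "t \<le> T"
  shows "((\<lambda>r. vel mu (psi r)) has_integral (traj mu x0 psi t - traj mu x0 psi s)) {s..t}"
proof -
  have i: "(\<lambda>r. vel mu (psi r)) integrable_on {a..b}" if "0 \<le> a" "b \<le> T" for a b
    using integrable_on_subinterval[OF assms(1)] that by auto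
  have "integral {0..s} (\<lambda>r. vel mu (psi r)) + integral {s..t} (\<lambda>r. vel mu (psi r))
      = integral {0..t} (\<lambda>r. vel mu (psi r))"
    using assms i by (intro Henstock_Kurzweil_Integration.integral_combine) auto
  moreover have "((\<lambda>r. vel mu (psi r)) has_integral integral {s..t} (\<lambda>r. vel mu (psi r))) {s..t}"
    using i assms by (intro integrable_integral) auto
  moreover have "traj mu x0 psi t - traj mu x0 psi s
      = integral {0..t} (\<lambda>r. vel mu (psi r)) - integral {0..s} (\<lambda>r. vel mu (psi r))"
    by (simp add: traj_def)
  ultimately show ?thesis
    by (metis add_diff_cancel_left')
qed

text \<open>Adding back the drift \<open>(1, 0)\<close> leaves a velocity of norm exactly
  \<open>mu\<close>; integrate.\<close>

lemma traj_increment_bound: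
  assumes "(\<lambda>s. vel mu (psi s)) integrable_on {0..T}" "0 \<le> s" "s \<le> t" "t \<le> T" "0 \<le> mu"
  shows "norm (traj mu x0 psi t - traj mu x0 psi s + (t - s) *\<^sub>R (1, 0)) \<le> mu * (t - s)"
proof -
  have 1: "((\<lambda>r. (1, 0) :: real \<times> real) has_integral ((t - s) *\<^sub>R (1, 0))) {s..t}"
    using has_integral_const_real[of "(1, 0) :: real \<times> real" s t] assms by simp
  have "norm (vel mu p + (1, 0)) = mu" for p
    using assms by (simp add: vel_eq del: scaleR_Pair)
  then show ?thesis
    using has_integral_bound_real[OF assms(5) _ has_integral_add[OF traj_increment[OF assms(1-4), of x0] 1], of "{}"]
      assms by auto
qed

lemma traj_continuous:
  assumes "(\<lambda>s. vel mu (psi s)) integrable_on {0..T}"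
  shows "continuous_on {0..T} (traj mu x0 psi)"
  unfolding traj_def by (intro continuous_intros indefinite_integral_continuous_1 assms)

section \<open>The free part of an optimal trajectory\<close>

text \<open>The equality case of Cauchy-Schwarz: the expanded square of
  \<open>norm (v - c *\<^sub>R u)\<close> is at most 0.\<close>

lemma Cauchy_Schwarz_extremal:
  fixes u v :: "'a :: real_inner"
  assumes "norm u = 1" "norm v \<le> c" "c \<le> u \<bullet> v"
  shows "v = c *\<^sub>R u"
proof -
  have "c \<ge> 0"
    using assms(2) norm_ge_zero order_trans by blast
  have "(norm (v - c *\<^sub>R u))\<^sup>2 = (norm v)\<^sup>2 - 2 * c * (u \<bullet> v) + c\<^sup>2"
    using assms(1) by (simp add: power2_norm_eq_inner inner_diff_left inner_diff_right
        algebra_simps inner_commute power2_eq_square[of c] norm_eq_1)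
  also have "\<dots> \<le> c\<^sup>2 - 2 * c * c + c\<^sup>2"
    using assms \<open>c \<ge> 0\<close> by (intro add_mono diff_mono power_mono mult_left_mono) auto
  finally have "(norm (v - c *\<^sub>R u))\<^sup>2 \<le> 0"
    by (simp add: power2_eq_square)
  then show ?thesis
    by simp
qed

lemma optimalD:
  assumes "optimal mu x0 T psi" "admissible mu x0 T psi'"
  shows "norm (traj mu x0 psi' T) \<le> norm (traj mu x0 psi T)"
  using assms by (simp add: optimal_def power2_le_iff_abs_le)

lemma optimal_integrable:
  "optimal mu x0 T psi \<Longrightarrow> (\<lambda>s. vel mu (psi s)) integrable_on {0..T}"
  by (simp add: optimal_def admissible_def)

text \<open>If heading u on [a,b], with the old increments afterwards, is admissible, it does not decrease
  the u-component of the final position; the equality case of Cauchy-Schwarz does the rest.\<close>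

lemma optimal_forces_increment:
  assumes opt: "optimal mu x0 T psi" and mu: "0 \<le> mu"
    and ab: "0 \<le> a" "a \<le> b" "b \<le> T"
    and nz: "traj mu x0 psi T \<noteq> 0"
    and u: "u = traj mu x0 psi T /\<^sub>R norm (traj mu x0 psi T)"
    and mid: "\<And>t. a \<le> t \<Longrightarrow> t \<le> b \<Longrightarrow>
      1 \<le> norm (traj mu x0 psi a + (t - a) *\<^sub>R (mu *\<^sub>R u - (1, 0)))"
    and later: "\<And>t. b \<le> t \<Longrightarrow> t \<le> T \<Longrightarrow>
      1 \<le> norm (traj mu x0 psi t
        + ((b - a) *\<^sub>R (mu *\<^sub>R u - (1, 0)) - (traj mu x0 psi b - traj mu x0 psi a)))"
  shows "traj mu x0 psi b - traj mu x0 psi a = (b - a) *\<^sub>R (mu *\<^sub>R u - (1, 0))"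
proof -
  let ?x = "traj mu x0 psi" and ?w = "mu *\<^sub>R u - (1, 0)"
  note int = optimal_integrable[OF opt]
  have nu: "norm u = 1"
    using nz by (simp add: u)
  obtain p where p: "u = (cos p, sin p)"
    using unit_vector_angle[OF nu] .
  have w: "vel mu p = ?w"
    by (simp add: vel_eq p)
  \<comment> \<open>After \<open>b\<close> the old heading is kept, so there the new path is the old
    one shifted by a constant vector.\<close>
  define psi' where "psi' = switch a psi (switch b (\<lambda>_. p) psi)"
  have int0: "(\<lambda>s. vel mu (psi s)) integrable_on {0..a}"
    using integrable_on_subinterval[OF int] ab by auto
  have h1: "((\<lambda>s. vel mu (switch b (\<lambda>_. p) psi s)) has_integral ((t - a) *\<^sub>R ?w)) {a..t}"
    if "a \<le> t" "t \<le> b" for t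
    using vel_const_has_integral[OF that(1), of mu p] unfolding w
    by (rule has_integral_eq[rotated]) (use that in \<open>simp add: switch_def w\<close>)
  have h2: "((\<lambda>s. vel mu (switch b (\<lambda>_. p) psi s)) has_integral ((b - a) *\<^sub>R ?w + (?x t - ?x b))) {a..t}"
    if "b \<le> t" "t \<le> T" for t
    by (rule has_integral_combine[OF ab(2) that(1) h1[OF ab(2) order_refl]])
      (rule vel_switch_after_has_integral, rule traj_increment[OF int], use ab that in auto)
  have x1: "traj mu x0 psi' t = ?x a + (t - a) *\<^sub>R ?w" if "a \<le> t" "t \<le> b" for t
    unfolding psi'_def using that ab by (intro traj_switch_after int0 h1) auto
  have x2: "traj mu x0 psi' t = ?x a + ((b - a) *\<^sub>R ?w + (?x t - ?x b))" if "b \<le> t" "t \<le> T" for t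
    unfolding psi'_def using that ab by (intro traj_switch_after int0 h2) auto
  have x2': "traj mu x0 psi' t = ?x t + ((b - a) *\<^sub>R ?w - (?x b - ?x a))" if "b \<le> t" "t \<le> T" for t
    using x2[OF that] by (simp only: algebra_simps)
  have "admissible mu x0 T psi'"
    unfolding admissible_def
  proof (intro conjI ballI)
    show "(\<lambda>s. vel mu (psi' s)) integrable_on {0..T}"
      using vel_switch_has_integral[OF ab(1) _ int0 h2[OF ab(3) order_refl]] ab
      unfolding psi'_def has_integral_integrable_integral by simp
    fix t assume t: "t \<in> {0..T}"
    consider "t \<le> a" | "a \<le> t" "t \<le> b" | "b \<le> t" by linarith
    then show "1 \<le> norm (traj mu x0 psi' t)"
    proof cases
      case 1
      then show ?thesis
        using opt t by (simp add: psi'_def traj_switch_before optimal_def admissible_def)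
    next
      case 2
      then show ?thesis
        using mid[of t] x1 by simp
    next
      case 3
      then show ?thesis
        using later[of t] x2' t by simp
    qed
  qed
  from optimalD[OF opt this] have le: "norm (traj mu x0 psi' T) \<le> norm (?x T)" .
  \<comment> \<open>\<open>P\<close> is the displacement on \<open>[a, b]\<close> with the drift
    removed. The drift is common to both trajectories, so only \<open>P\<close> is compared with
    \<open>(mu * (b - a)) *\<^sub>R u\<close>.\<close>
  define P where "P = ?x b - ?x a + (b - a) *\<^sub>R (1, 0)"
  have xT: "traj mu x0 psi' T = ?x T + ((mu * (b - a)) *\<^sub>R u - P)"
    using x2[OF ab(3) order_refl] by (simp add: P_def algebra_simps)
  \<comment> \<open>Projecting on \<open>u\<close> loses nothing for \<open>?x T\<close>, a positive
    multiple of \<open>u\<close>; optimality therefore gives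
    \<open>mu * (b - a) \<le> u \<bullet> P\<close>, the reverse of the speed bound.\<close>
  have "u \<bullet> ?x T + (mu * (b - a) - u \<bullet> P) = u \<bullet> traj mu x0 psi' T"
    using nu by (simp add: xT inner_add inner_diff norm_eq_1)
  also have "\<dots> \<le> norm (traj mu x0 psi' T)"
    using norm_cauchy_schwarz[of u "traj mu x0 psi' T"] nu by simp
  also note le
  also have "norm (?x T) = u \<bullet> ?x T"
    using nz by (simp add: u dot_square_norm power2_eq_square)
  finally have "mu * (b - a) \<le> u \<bullet> P"
    by simp
  moreover have "norm P \<le> mu * (b - a)"
    unfolding P_def by (rule traj_increment_bound[OF int]) (use ab mu in auto)
  ultimately have "P = (mu * (b - a)) *\<^sub>R u"
    by (intro Cauchy_Schwarz_extremal nu)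
  then show ?thesis
    by (simp add: P_def algebra_simps)
qed

text \<open>On \<open>[s, T]\<close> with \<open>s > te\<close> the path keeps a positive distance
  from the circle, so on short intervals the heading \<open>u\<close> is admissible and forces the
  increments. Short intervals are joined by bisection, and \<open>te\<close> itself is reached by
  continuity.\<close>

lemma tail_straight:
  assumes opt: "optimal mu x0 T psi" and mu: "0 \<le> mu" "mu < 1"
    and te: "0 \<le> te" "te < T"
    and leave: "\<forall>t\<in>{te<..T}. norm (traj mu x0 psi t) > 1"
    and u: "u = traj mu x0 psi T /\<^sub>R norm (traj mu x0 psi T)"
    and t: "te \<le> t" "t \<le> T"
  shows "traj mu x0 psi t = traj mu x0 psi te + (t - te) *\<^sub>R (mu *\<^sub>R u - (1, 0))"
proof -
  let ?x = "traj mu x0 psi" and ?w = "mu *\<^sub>R u - (1, 0)"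
  note int = optimal_integrable[OF opt]
  have cont: "continuous_on {0..T} ?x"
    by (rule traj_continuous[OF int])
  have nz: "?x T \<noteq> 0"
    using leave te by (metis greaterThanAtMost_iff norm_zero not_one_less_zero order_refl)
  then have nu: "norm u = 1"
    by (simp add: u)
  have main: "?x T - ?x s = (T - s) *\<^sub>R ?w" if s: "te < s" "s \<le> T" for s
  proof -
    have "continuous_on {s..T} (\<lambda>t. norm (?x t))"
      by (rule continuous_on_norm, rule continuous_on_subset[OF cont]) (use te s in auto)
    then obtain m where m: "m \<in> {s..T}" "\<And>t. t \<in> {s..T} \<Longrightarrow> norm (?x m) \<le> norm (?x t)"
      using continuous_attains_inf[of "{s..T}" "\<lambda>t. norm (?x t)"] s by auto
    define d where "d = norm (?x m) - 1"
    have d: "d > 0"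
      using leave m(1) s by (auto simp: d_def)
    \<comment> \<open>Freed of the drift, both displacements have length at most
      \<open>mu * (t - a)\<close>.\<close>
    have dev: "norm ((t - a) *\<^sub>R ?w - (?x t - ?x a)) \<le> 2 * (t - a)"
      if "s \<le> a" "a \<le> t" "t \<le> T" for a t
    proof -
      have "(t - a) *\<^sub>R ?w - (?x t - ?x a) =
          ((t - a) * mu) *\<^sub>R u - (?x t - ?x a + (t - a) *\<^sub>R (1, 0))"
        by (simp add: algebra_simps)
      also have "norm \<dots> \<le> norm (((t - a) * mu) *\<^sub>R u) + norm (?x t - ?x a + (t - a) *\<^sub>R (1, 0))"
        by (rule norm_triangle_ineq4)
      also have "\<dots> \<le> (t - a) * mu + mu * (t - a)"
        using traj_increment_bound[OF int _ that(2,3) mu(1), of x0] that s te mu nu by simp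
      also have "\<dots> \<le> 2 * (t - a)"
        using mult_left_le[of mu "t - a"] mu that by (simp add: mult.commute)
      finally show ?thesis .
    qed
    have far: "1 \<le> norm (?x t + v)" if "s \<le> t" "t \<le> T" "norm v \<le> d" for t v
      using m(2)[of t] that norm_diff_ineq[of "?x t" v] by (simp add: d_def)
    have "s \<le> s \<and> T \<le> T \<longrightarrow> ?x T - ?x s = (T - s) *\<^sub>R ?w"
    proof (rule Bolzano[OF s(2), of "\<lambda>a b. s \<le> a \<and> b \<le> T \<longrightarrow> ?x b - ?x a = (b - a) *\<^sub>R ?w"])
      fix a b c
      assume ab: "s \<le> a \<and> b \<le> T \<longrightarrow> ?x b - ?x a = (b - a) *\<^sub>R ?w"
        and bc: "s \<le> b \<and> c \<le> T \<longrightarrow> ?x c - ?x b = (c - b) *\<^sub>R ?w" and o: "a \<le> b" "b \<le> c"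
      show "s \<le> a \<and> c \<le> T \<longrightarrow> ?x c - ?x a = (c - a) *\<^sub>R ?w"
      proof
        assume "s \<le> a \<and> c \<le> T"
        then have "?x b - ?x a = (b - a) *\<^sub>R ?w" "?x c - ?x b = (c - b) *\<^sub>R ?w"
          using ab bc o by auto
        then have "?x c - ?x a = (b - a) *\<^sub>R ?w + (c - b) *\<^sub>R ?w"
          by (metis add.commute diff_add_cancel diff_diff_eq2)
        then show "?x c - ?x a = (c - a) *\<^sub>R ?w"
          by (simp flip: scaleR_left_distrib del: scaleR_right_diff_distrib scaleR_Pair)
      qed
    next
      fix y
      \<comment> \<open>The length \<open>d / 2\<close> keeps the deviation, at most
        \<open>2 * (b - a)\<close>, below the margin \<open>d\<close>.\<close>
      have "?x b - ?x a = (b - a) *\<^sub>R ?w"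
        if ab: "s \<le> a" "b \<le> T" "a \<le> b" "b - a < d / 2" for a b
      proof (rule optimal_forces_increment[OF opt mu(1) _ ab(3,2) nz u])
        fix t assume t: "a \<le> t" "t \<le> b"
        show "1 \<le> norm (?x a + (t - a) *\<^sub>R ?w)"
          using far[of t "(t - a) *\<^sub>R ?w - (?x t - ?x a)"] dev[of a t] t ab by (simp add: algebra_simps)
      next
        fix t assume t: "b \<le> t" "t \<le> T"
        show "1 \<le> norm (?x t + ((b - a) *\<^sub>R ?w - (?x b - ?x a)))"
          using far[of t] dev[of a b] t ab by simp
      qed (use te s ab in auto)
      then show "\<exists>d>0. \<forall>a b. a \<le> y \<and> y \<le> b \<and> b - a < d \<longrightarrow>
          s \<le> a \<and> b \<le> T \<longrightarrow> ?x b - ?x a = (b - a) *\<^sub>R ?w"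
        using d by (intro exI[of _ "d / 2"]) force
    qed
    then show ?thesis
      by simp
  qed
  have cl: "closure {te<..T} = {te..T}"
    using te by simp
  have "continuous_on (closure {te<..T}) (\<lambda>s. ?x T - ?x s - (T - s) *\<^sub>R ?w)"
    unfolding cl by (intro continuous_intros continuous_on_subset[OF cont]) (use te in auto)
  then have "?x T - ?x te - (T - te) *\<^sub>R ?w = 0"
    by (rule continuous_constant_on_closure) (use main te in \<open>auto simp: cl\<close>)
  then have te0: "?x T - ?x te = (T - te) *\<^sub>R ?w"
    by simp
  show ?thesis
  proof (cases "t = te")
    case False
    then have "?x T - ?x t = (T - t) *\<^sub>R ?w"
      using main t by simp
    then have "?x t = ?x te + ((T - te) *\<^sub>R ?w - (T - t) *\<^sub>R ?w)"
      using te0 by (metis add.commute add_diff_cancel_left diff_add_cancel diff_diff_eq2)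
    then show ?thesis
      by (simp flip: scaleR_left_diff_distrib del: scaleR_right_diff_distrib scaleR_Pair)
  qed simp
qed

text \<open>Otherwise reflecting the rest of the trajectory when it meets the x-axis would give
  an optimal trajectory whose free part has a kink.\<close>

lemma exit_heading_upward:
  assumes opt: "optimal mu x0 T psi" and mu: "0 < mu" "mu < 1"
    and te: "0 \<le> te" "te < T"
    and leave: "\<forall>t\<in>{te<..T}. norm (traj mu x0 psi t) > 1"
    and u: "u = traj mu x0 psi T /\<^sub>R norm (traj mu x0 psi T)"
    and up: "snd (traj mu x0 psi te) > 0"
  shows "snd u > 0"
proof (rule ccontr)
  let ?x = "traj mu x0 psi"
  note int = optimal_integrable[OF opt]
  note straight = tail_straight[OF opt less_imp_le[OF mu(1)] mu(2) te leave u]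
  have nT: "norm (?x T) > 1"
    using leave te by auto
  then have snd_T: "snd (?x T) = norm (?x T) * snd u"
    by (auto simp: u field_simps)
  have snd_t: "snd (?x t) = snd (?x te) + (t - te) * (mu * snd u)" if "te \<le> t" "t \<le> T" for t
    using straight[OF that] by simp
  assume "\<not> snd u > 0"
  \<comment> \<open>With horizontal \<open>u\<close> the height would keep its positive value from
    \<open>te\<close> on, while \<open>snd (?x T)\<close> would vanish.\<close>
  moreover have "snd u \<noteq> 0"
    using snd_t[of T] snd_T te up by auto
  ultimately have neg: "snd u < 0"
    by simp
  \<comment> \<open>The time at which the straight tail, descending at rate
    \<open>mu * - snd u\<close>, meets the x-axis.\<close>
  define c where "c = te + snd (?x te) / (mu * - snd u)"
  have nz: "mu * - snd u > 0"
    using neg mu by (simp add: mult_pos_neg)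
  have c_te: "te < c"
    using divide_pos_pos[OF up nz] unfolding c_def by simp
  have "snd (?x te) + (T - te) * (mu * snd u) < 0"
    using snd_t[of T] te snd_T mult_pos_neg[of "norm (?x T)" "snd u", OF _ neg] nT by linarith
  then have "snd (?x te) < (T - te) * (mu * - snd u)"
    by simp
  then have "snd (?x te) / (mu * - snd u) < T - te"
    using nz by (simp only: pos_divide_less_eq)
  then have c_T: "c < T"
    by (simp add: c_def)
  have snd_c: "snd (?x c) = 0"
    using snd_t[of c] c_te c_T nz neg mu by (simp add: c_def field_simps)
  define refl :: "real \<times> real \<Rightarrow> real \<times> real" where "refl = (\<lambda>v. (fst v, - snd v))"
  have refl: "bounded_linear refl"
    unfolding refl_def by (intro bounded_linear_Pair bounded_linear_minus bounded_linear_fst bounded_linear_snd)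
  have norm_refl: "norm (refl v) = norm v" for v
    by (cases v) (simp add: refl_def norm_Pair)
  have vel_refl: "vel mu (- p) = refl (vel mu p)" for p
    by (simp add: vel_def refl_def)
  \<comment> \<open>Negating the heading reflects the velocity in the x-axis. The point
    \<open>?x c\<close> is fixed by the reflection and norms are kept, so the new path is admissible
    and ends equally far away.\<close>
  define psi' where "psi' = switch c psi (\<lambda>s. - psi s)"
  have int0: "(\<lambda>s. vel mu (psi s)) integrable_on {0..c}"
    using integrable_on_subinterval[OF int] c_te c_T te by auto
  have h: "((\<lambda>s. vel mu (- psi s)) has_integral refl (?x t - ?x c)) {c..t}" if "c \<le> t" "t \<le> T" for t
    unfolding vel_refl using that c_te te
    by (intro has_integral_linear[OF traj_increment[OF int] refl, unfolded o_def]) auto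
  have before: "traj mu x0 psi' t = ?x t" if "t \<le> c" for t
    unfolding psi'_def using that by (rule traj_switch_before)
  have after: "traj mu x0 psi' t = refl (?x t)" if "c \<le> t" "t \<le> T" for t
  proof -
    have "traj mu x0 psi' t = ?x c + refl (?x t - ?x c)"
      unfolding psi'_def using that c_te te by (intro traj_switch_after int0 h) auto
    then show ?thesis
      using snd_c by (simp add: refl_def prod_eq_iff)
  qed
  have same_norm: "norm (traj mu x0 psi' t) = norm (?x t)" if "t \<le> T" for t
    using before[of t] after[of t] norm_refl that by (cases "t \<le> c") auto
  have "(\<lambda>s. vel mu (psi' s)) integrable_on {0..T}"
    using vel_switch_has_integral[OF _ _ int0 h[OF _ order_refl]] c_te c_T te
    unfolding psi'_def has_integral_integrable_integral by simp
  then have opt': "optimal mu x0 T psi'"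
    using opt same_norm by (auto simp: optimal_def admissible_def)
  define u' where "u' = traj mu x0 psi' T /\<^sub>R norm (traj mu x0 psi' T)"
  have u': "u' = refl u"
    using after[of T] c_T by (simp add: u'_def u refl_def norm_refl[unfolded refl_def])
  \<comment> \<open>Straightness of the reflected optimum from \<open>te\<close> on prescribes the
    rising direction \<open>refl u\<close> already before \<open>c\<close>, where the path is still
    the old one, which has height 0 at \<open>c\<close>.\<close>
  have "traj mu x0 psi' c = traj mu x0 psi' te + (c - te) *\<^sub>R (mu *\<^sub>R u' - (1, 0))"
    by (rule tail_straight[OF opt' _ mu(2) te _ u'_def]) (use leave same_norm c_te c_T mu in auto)
  then have "snd (?x c) = snd (?x te) + (c - te) * (mu * - snd u)"
    using c_te before[of te] before[of c] by (simp add: u' refl_def)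
  then show False
    using snd_c up nz c_te by (smt (verit) mult_pos_pos)
qed

text \<open>A negative product would send the tail into the disc. With a positive one, flight along
  \<open>?w\<close> from a slightly earlier point of the ride is admissible, hence forced; but such
  a flight would have left the circle before \<open>te\<close>.\<close>

lemma exit_tangential:
  assumes opt: "optimal mu x0 T psi" and mu: "0 \<le> mu" "mu < 1"
    and te: "0 \<le> ts" "ts < te" "te < T"
    and ride: "\<And>t. ts \<le> t \<Longrightarrow> t \<le> te \<Longrightarrow> norm (traj mu x0 psi t) = 1"
    and leave: "\<forall>t\<in>{te<..T}. norm (traj mu x0 psi t) > 1"
    and u: "u = traj mu x0 psi T /\<^sub>R norm (traj mu x0 psi T)"
  shows "traj mu x0 psi te \<bullet> (mu *\<^sub>R u - (1, 0)) = 0"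
proof -
  let ?x = "traj mu x0 psi" and ?w = "mu *\<^sub>R u - (1, 0)"
  note int = optimal_integrable[OF opt]
  have "0 \<le> te"
    using te by simp
  note straight = tail_straight[OF opt mu this te(3) leave u]
  have nz: "?x T \<noteq> 0"
    using leave te by (metis greaterThanAtMost_iff norm_zero not_one_less_zero order_refl)
  have norm_line: "(norm (q + t *\<^sub>R w))\<^sup>2 = (norm q)\<^sup>2 + 2 * t * (q \<bullet> w) + t\<^sup>2 * (norm w)\<^sup>2"
    for q w :: "real \<times> real" and t
    by (simp add: power2_norm_eq_inner inner_add_left inner_add_right inner_commute
        power2_eq_square[of t] algebra_simps)
  have np: "norm (?x te) = 1"
    using ride te by simp
  have "?x te \<bullet> ?w \<ge> 0"
  proof (rule ccontr)
    assume neg: "\<not> ?thesis"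
    \<comment> \<open>The squared norm along the tail, expanded and divided by \<open>t\<close>;
      afterwards \<open>t\<close> tends to 0.\<close>
    have "0 \<le> 2 * (?x te \<bullet> ?w) + t * (norm ?w)\<^sup>2" if t: "0 < t" "t \<le> T - te" for t
    proof -
      have "1 \<le> (norm (?x te + t *\<^sub>R ?w))\<^sup>2"
        using straight[of "te + t"] leave[rule_format, of "te + t"] t by (simp add: one_le_power)
      then have "0 \<le> t * (2 * (?x te \<bullet> ?w) + t * (norm ?w)\<^sup>2)"
        using np unfolding norm_line by (simp add: algebra_simps power2_eq_square)
      then show ?thesis
        using t by (simp add: zero_le_mult_iff)
    qed
    moreover have "((\<lambda>t. 2 * (?x te \<bullet> ?w) + t * (norm ?w)\<^sup>2) \<longlongrightarrow> 2 * (?x te \<bullet> ?w) + 0 * (norm ?w)\<^sup>2) (at_right 0)"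
      by (intro tendsto_intros)
    moreover have "eventually (\<lambda>t. t \<in> {0<..<T - te}) (at_right 0)"
      using te by (intro eventually_at_right_real) auto
    ultimately have "0 \<le> 2 * (?x te \<bullet> ?w) + 0 * (norm ?w)\<^sup>2"
      by (intro tendsto_lowerbound[of _ _ "at_right (0::real)"]) (auto elim!: eventually_mono)
    with neg show False
      by simp
  qed
  moreover have "\<not> ?x te \<bullet> ?w > 0"
  proof
    assume pos: "?x te \<bullet> ?w > 0"
    \<comment> \<open>By continuity there is an earlier instant \<open>r\<close> of the ride at
      which \<open>?w\<close> still points outwards.\<close>
    have "continuous_on {ts..te} (\<lambda>t. ?x t \<bullet> ?w)"
      by (intro continuous_intros continuous_on_subset[OF traj_continuous[OF int]]) (use te in auto)
    then have "((\<lambda>t. ?x t \<bullet> ?w) \<longlongrightarrow> ?x te \<bullet> ?w) (at te within {ts..te})"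
      using te by (simp add: continuous_on_def)
    then have "eventually (\<lambda>t. ?x t \<bullet> ?w > 0) (at te within {ts..te})"
      using pos by (rule order_tendstoD)
    moreover have "eventually (\<lambda>t. t \<in> {ts..te} \<and> t \<noteq> te) (at te within {ts..te})"
      by (simp add: eventually_at_filter)
    ultimately have "eventually (\<lambda>t. ?x t \<bullet> ?w > 0 \<and> t \<in> {ts..te} \<and> t \<noteq> te) (at te within {ts..te})"
      by (rule eventually_conj)
    moreover have "at te within {ts..te} \<noteq> bot"
      using te by (simp add: at_within_Icc_at_left)
    ultimately obtain r where r: "r \<in> {ts..te}" "r \<noteq> te" "?x r \<bullet> ?w > 0"
      using eventually_happens' by blast
    have clear: "1 \<le> norm (?x r + t *\<^sub>R ?w)" if "0 \<le> t" for t
    proof -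
      have "1 \<le> (norm (?x r + t *\<^sub>R ?w))\<^sup>2"
        unfolding norm_line using r ride[of r] that by simp
      then show ?thesis
        by (rule power2_le_imp_le[of 1, OF _ norm_ge_zero, unfolded power_one])
    qed
    have "?x te - ?x r = (te - r) *\<^sub>R ?w"
    proof (rule optimal_forces_increment[OF opt mu(1) _ _ _ nz u])
      show "1 \<le> norm (?x r + (t - r) *\<^sub>R ?w)" if "r \<le> t" for t
        using clear that by simp
      show "1 \<le> norm (?x t + ((te - r) *\<^sub>R ?w - (?x te - ?x r)))" if "te \<le> t" "t \<le> T" for t
      proof -
        \<comment> \<open>The shifted tail continues the ray from \<open>?x r\<close> along
          \<open>?w\<close>, to which \<open>clear\<close> applies.\<close>
        have "?x t + ((te - r) *\<^sub>R ?w - (?x te - ?x r)) = ?x r + ((te - r) *\<^sub>R ?w + (t - te) *\<^sub>R ?w)"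
          unfolding straight[OF that] by (simp del: scaleR_right_diff_distrib)
        also have "\<dots> = ?x r + (t - r) *\<^sub>R ?w"
          by (simp flip: scaleR_left_distrib)
        finally have eq: "?x t + ((te - r) *\<^sub>R ?w - (?x te - ?x r)) = ?x r + (t - r) *\<^sub>R ?w" .
        show ?thesis
          unfolding eq using that r by (intro clear) simp
      qed
    qed (use te r in auto)
    then have "?x te = ?x r + (te - r) *\<^sub>R ?w"
      by (simp add: algebra_simps)
    then have "(norm (?x te))\<^sup>2 = (norm (?x r))\<^sup>2 + 2 * (te - r) * (?x r \<bullet> ?w) + (te - r)\<^sup>2 * (norm ?w)\<^sup>2"
      using norm_line by simp
    moreover have "2 * (te - r) * (?x r \<bullet> ?w) > 0"
      using r by simp
    moreover have "(te - r)\<^sup>2 * (norm ?w)\<^sup>2 \<ge> 0"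
      by simp
    ultimately show False
      using ride[of r] np r by (simp only: atLeastAtMost_iff)
  qed
  ultimately show ?thesis
    by simp
qed

section \<open>Riding the Proximity Circle\<close>

text \<open>The chord between two points of the circle is orthogonal to the direction of its
  mid-angle, so comparing it with the drift bounds the admissible chord length.\<close>

lemma chord_speed_bound:
  assumes int: "(\<lambda>s. vel mu (psi s)) integrable_on {0..T}" and mu: "0 \<le> mu"
    and st: "0 \<le> s" "s \<le> t" "t \<le> T"
    and a: "traj mu x0 psi s = (cos a, sin a)" and b: "traj mu x0 psi t = (cos b, sin b)"
  shows "(2 * sin ((b - a) / 2) - (t - s) * sin ((a + b) / 2))\<^sup>2
      \<le> (t - s)\<^sup>2 * (mu\<^sup>2 - (cos ((a + b) / 2))\<^sup>2)"
proof -
  \<comment> \<open>\<open>m\<close> is the mid-angle, \<open>d\<close> the signed chord length,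
    \<open>h\<close> the time spent.\<close>
  define m d h where "m = (a + b) / 2" and "d = 2 * sin ((b - a) / 2)" and "h = t - s"
  have "cos b - cos a = - d * sin m"
    using cos_diff_cos[of a b] unfolding m_def d_def by (simp add: mult.commute mult.left_commute)
  moreover have "sin b - sin a = d * cos m"
    unfolding sin_diff_sin m_def d_def by (simp add: add.commute)
  ultimately have "traj mu x0 psi t - traj mu x0 psi s + (t - s) *\<^sub>R (1, 0) = (h - d * sin m, d * cos m)"
    by (simp add: a b h_def)
  then have "norm (h - d * sin m, d * cos m) \<le> mu * h"
    using traj_increment_bound[OF int st mu, of x0] by (simp add: h_def)
  then have "(norm (h - d * sin m, d * cos m))\<^sup>2 \<le> (mu * h)\<^sup>2"
    by (rule power_mono) simp
  then have "(h - d * sin m)\<^sup>2 + (d * cos m)\<^sup>2 \<le> (mu * h)\<^sup>2"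
    by (simp add: norm_Pair)
  \<comment> \<open>The right-hand side splits the drift-free displacement into its tangential and
    radial parts at angle \<open>m\<close>.\<close>
  moreover have "(h - d * sin m)\<^sup>2 + (d * cos m)\<^sup>2 = (d - h * sin m)\<^sup>2 + h\<^sup>2 * (cos m)\<^sup>2"
    using sin_cos_squared_add[of m] by (simp add: power2_eq_square) algebra
  ultimately show ?thesis
    unfolding m_def[symmetric] d_def[symmetric] h_def[symmetric]
    by (simp add: algebra_simps power_mult_distrib)
qed

section \<open>Speeds along the circle and the arc time\<close>

text \<open>The larger of the two tangential speeds with which the Evader can stay on the circle at
  angle \<open>th\<close>: the drift contributes \<open>sin th\<close>, and cancelling its radial
  part \<open>- cos th\<close> leaves the root as the Evader's own share.\<close>

definition fast :: "real \<Rightarrow> real \<Rightarrow> real" where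
  "fast mu th = sin th + sqrt (mu\<^sup>2 - (cos th)\<^sup>2)"

text \<open>The reciprocal of \<open>fast\<close> in rationalised form: time per unit angle, the
  integrand behind \<open>t_arc\<close>.\<close>

definition slowness :: "real \<Rightarrow> real \<Rightarrow> real" where
  "slowness mu th = (sin th - sqrt (mu\<^sup>2 - (cos th)\<^sup>2)) / (1 - mu\<^sup>2)"

lemma fast_slowness:
  assumes "0 < mu" "mu < 1" "(cos th)\<^sup>2 \<le> mu\<^sup>2"
  shows "fast mu th * slowness mu th = 1"
proof -
  have "mu\<^sup>2 < 1"
    using assms by (simp add: power_less_one_iff)
  have "fast mu th * (sin th - sqrt (mu\<^sup>2 - (cos th)\<^sup>2)) = (sin th)\<^sup>2 - (sqrt (mu\<^sup>2 - (cos th)\<^sup>2))\<^sup>2"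
    by (simp add: fast_def power2_eq_square algebra_simps)
  also have "\<dots> = 1 - mu\<^sup>2"
    using assms by (simp add: sin_squared_eq)
  finally show ?thesis
    using \<open>mu\<^sup>2 < 1\<close> by (simp add: slowness_def)
qed

lemma continuous_on_slowness: "continuous_on S (slowness mu)"
  unfolding slowness_def divide_inverse by (intro continuous_intros)

text \<open>No bound on \<open>cos th\<close> is needed: Isabelle's square root is odd, hence monotone on all reals.\<close>

lemma slowness_pos:
  assumes "0 < mu" "mu < 1" "sin th > 0"
  shows "slowness mu th > 0"
proof -
  have "mu\<^sup>2 < 1"
    using assms by (simp add: power_less_one_iff)
  then have "mu\<^sup>2 - (cos th)\<^sup>2 < (sin th)\<^sup>2"
    by (simp add: sin_squared_eq)
  then have "sqrt (mu\<^sup>2 - (cos th)\<^sup>2) < sqrt ((sin th)\<^sup>2)"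
    by (rule real_sqrt_less_mono)
  then show ?thesis
    using assms \<open>mu\<^sup>2 < 1\<close> by (simp add: slowness_def)
qed

lemma slowness_le:
  assumes "0 < mu" "mu < 1" "(cos th)\<^sup>2 \<le> mu\<^sup>2"
  shows "slowness mu th \<le> 1 / (1 - mu\<^sup>2)"
proof -
  have "mu\<^sup>2 < 1"
    using assms by (simp add: power_less_one_iff)
  moreover have "sin th - sqrt (mu\<^sup>2 - (cos th)\<^sup>2) \<le> 1"
    using assms sin_le_one[of th] real_sqrt_ge_zero[of "mu\<^sup>2 - (cos th)\<^sup>2"] by linarith
  ultimately show ?thesis
    unfolding slowness_def by (intro divide_right_mono) auto
qed

text \<open>The sine part of \<open>slowness\<close> integrates to the difference of cosines;
  pulling \<open>mu\<close> out of the root gives the other term. The order \<open>a \<le> b\<close>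
  selects the positive branch of \<open>oint\<close>.\<close>

lemma t_arc_eq_integral:
  assumes "0 < mu" "mu < 1" "a \<le> b"
  shows "t_arc mu a b = integral {a..b} (slowness mu)"
proof -
  have "mu * sqrt (1 - (cos th)\<^sup>2 / mu\<^sup>2) = sqrt (mu\<^sup>2 - (cos th)\<^sup>2)" for th
  proof -
    have "mu * sqrt (1 - (cos th)\<^sup>2 / mu\<^sup>2) = sqrt (mu\<^sup>2 * (1 - (cos th)\<^sup>2 / mu\<^sup>2))"
      using assms by (simp add: real_sqrt_mult)
    also have "mu\<^sup>2 * (1 - (cos th)\<^sup>2 / mu\<^sup>2) = mu\<^sup>2 - (cos th)\<^sup>2"
      using assms by (simp add: field_simps)
    finally show ?thesis .
  qed
  then have slow: "slowness mu = (\<lambda>th. (sin th - mu * sqrt (1 - (cos th)\<^sup>2 / mu\<^sup>2)) / (1 - mu\<^sup>2))"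
    by (simp add: slowness_def fun_eq_iff)
  have "((\<lambda>th. sin th) has_integral (- cos b - (- cos a))) {a..b}"
    by (rule fundamental_theorem_of_calculus[OF assms(3)])
      (auto intro!: derivative_eq_intros simp flip: has_real_derivative_iff_has_vector_derivative)
  moreover have "(\<lambda>th. sqrt (1 - (cos th)\<^sup>2 / mu\<^sup>2)) integrable_on {a..b}"
    unfolding divide_inverse by (intro integrable_continuous_real continuous_intros)
  ultimately have "(slowness mu has_integral
      ((- cos b - (- cos a)) - mu * integral {a..b} (\<lambda>th. sqrt (1 - (cos th)\<^sup>2 / mu\<^sup>2))) / (1 - mu\<^sup>2)) {a..b}"
    unfolding slow
    by (intro has_integral_divide has_integral_diff has_integral_mult_right integrable_integral)
  then show ?thesis
    using assms by (simp add: t_arc_def oint_def integral_unique diff_divide_distrib)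
qed

lemma t_arc_has_derivative:
  assumes "0 < mu" "mu < 1" "th \<in> {a..b}"
  shows "(t_arc mu a has_real_derivative slowness mu th) (at th within {a..b})"
proof (rule has_field_derivative_transform_within[OF _ zero_less_one assms(3)])
  show "((\<lambda>t. integral {a..t} (slowness mu)) has_real_derivative slowness mu th) (at th within {a..b})"
    by (intro integral_has_real_derivative continuous_on_slowness assms)
qed (simp add: t_arc_eq_integral assms)

lemma t_arc_MVT:
  assumes "0 < mu" "mu < 1" "a \<le> c" "c < d"
  obtains z where "c < z" "z < d" "t_arc mu a d - t_arc mu a c = (d - c) * slowness mu z"
proof -
  have D: "(t_arc mu a has_real_derivative slowness mu z) (at z)" if "c < z" "z < d" for z
  proof -
    have "at z within {a..d} = at z"
      using assms that by (intro at_within_interior) (auto simp: interior_atLeastAtMost_real)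
    then show ?thesis
      using t_arc_has_derivative[of mu z a d] assms that by simp
  qed
  have "continuous_on {a..d} (t_arc mu a)"
    using t_arc_has_derivative[OF assms(1,2)] by (intro DERIV_continuous_on) auto
  then have "continuous_on {c..d} (t_arc mu a)"
    by (rule continuous_on_subset) (use assms in auto)
  then obtain l z where z: "c < z" "z < d" "DERIV (t_arc mu a) z :> l"
      "t_arc mu a d - t_arc mu a c = (d - c) * l"
    using MVT[OF assms(4), of "t_arc mu a"] D real_differentiable_def by blast
  then show ?thesis
    using that[of z] DERIV_unique[OF z(3) D] by simp
qed

lemma t_arc_self: "t_arc mu a a = 0"
  by (simp add: t_arc_def oint_def)

text \<open>\<open>fast mu th\<close> is a root of the quadratic equation saying that the tangential
  velocity, with the drift added back, has norm \<open>mu\<close>.\<close>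

lemma vel_of_tangential_speed:
  assumes "0 < mu" "(cos th)\<^sup>2 \<le> mu\<^sup>2"
  shows "\<exists>p. vel mu p = fast mu th *\<^sub>R (- sin th, cos th)"
proof -
  let ?f = "fast mu th"
  have "(?f - sin th)\<^sup>2 = mu\<^sup>2 - (cos th)\<^sup>2"
    using assms by (simp add: fast_def)
  then have "(1 - ?f * sin th)\<^sup>2 + (?f * cos th)\<^sup>2 = mu\<^sup>2"
    using sin_cos_squared_add[of th] by algebra
  then have "norm ((1 - ?f * sin th) / mu, ?f * cos th / mu) = 1"
    using assms by (simp add: norm_Pair power_divide flip: add_divide_distrib)
  then obtain p where "((1 - ?f * sin th) / mu, ?f * cos th / mu) = (cos p, sin p)"
    by (rule unit_vector_angle)
  then have "mu * cos p = 1 - ?f * sin th" "mu * sin p = ?f * cos th"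
    using assms by (auto simp: field_simps)
  then have "vel mu p = ?f *\<^sub>R (- sin th, cos th)"
    by (simp add: vel_def)
  then show ?thesis
    by (rule exI)
qed

text \<open>The clock time \<open>G\<close> at which an angle is reached is strictly increasing. Its
  inverse \<open>Th\<close> moves with angular speed \<open>fast\<close>, since \<open>fast\<close>
  and \<open>slowness\<close> are reciprocal.\<close>

lemma fast_ride_exists:
  assumes mu: "0 < mu" "mu < 1" and ab: "0 < a" "a < b" "b < pi"
    and steep: "\<And>th. a \<le> th \<Longrightarrow> th \<le> b \<Longrightarrow> (cos th)\<^sup>2 \<le> mu\<^sup>2"
  obtains q Th where "Th (c + t_arc mu a b) = b"
    "\<And>t. c \<le> t \<Longrightarrow> t \<le> c + t_arc mu a b \<Longrightarrow>
       ((\<lambda>s. vel mu (q s)) has_integral ((cos (Th t), sin (Th t)) - (cos a, sin a))) {c..t}"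
proof -
  define G where "G th = c + t_arc mu a th" for th
  have D: "(G has_real_derivative slowness mu th) (at th within {a..b})" if "th \<in> {a..b}" for th
    unfolding G_def using that mu by (auto intro!: derivative_eq_intros t_arc_has_derivative)
  have G_mono: "G th1 < G th2" if th: "a \<le> th1" "th1 < th2" "th2 \<le> b" for th1 th2
  proof -
    obtain z where z: "th1 < z" "z < th2" "t_arc mu a th2 - t_arc mu a th1 = (th2 - th1) * slowness mu z"
      using t_arc_MVT[OF mu th(1,2)] .
    have "slowness mu z > 0"
      using z th ab mu by (intro slowness_pos sin_gt_zero) auto
    then have "(th2 - th1) * slowness mu z > 0"
      using th by simp
    then show ?thesis
      using z(3) by (simp add: G_def)
  qed
  have inj: "inj_on G {a..b}"
    by (rule linorder_inj_onI) (use G_mono in \<open>force+\<close>)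
  have contG: "continuous_on {a..b} G"
    using D by (rule DERIV_continuous_on)
  have Ga: "G a = c" and Gb: "G b = c + t_arc mu a b"
    by (simp_all add: G_def t_arc_self)
  define d where "d = c + t_arc mu a b"
  have cd: "c < d"
    using G_mono[of a b] ab Ga Gb by (simp add: d_def)
  define Th where "Th = inv_into {a..b} G"
  have Th_G: "Th (G th) = th" if "th \<in> {a..b}" for th
    using that inj by (simp add: Th_def)
  have img: "G ` {a..b} = {c..d}"
  proof (intro equalityI subsetI)
    fix y assume "y \<in> G ` {a..b}"
    then obtain th where "th \<in> {a..b}" "y = G th" by blast
    then show "y \<in> {c..d}"
      using G_mono[of a th] G_mono[of th b] Ga Gb by (cases "a = th"; cases "th = b") (auto simp: d_def)
  next
    fix y assume "y \<in> {c..d}"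
    then show "y \<in> G ` {a..b}"
      using IVT'[of G a y b] contG ab Ga Gb by (force simp: d_def)
  qed
  have Th_range: "Th t \<in> {a..b}" and G_Th: "G (Th t) = t" if "t \<in> {c..d}" for t
    using that img unfolding Th_def by (metis inv_into_into, metis f_inv_into_f)
  have contTh: "continuous_on {c..d} Th"
    using continuous_on_inv[OF contG compact_Icc, of Th] Th_G img by simp
  \<comment> \<open>The ends are left out; there continuity suffices for the fundamental theorem
    applied below.\<close>
  have DTh: "(Th has_real_derivative fast mu (Th t)) (at t)" if t: "c < t" "t < d" for t
  proof -
    have r: "Th t \<in> {a..b}" "G (Th t) = t"
      using Th_range[of t] G_Th[of t] t by auto
    have "Th t \<noteq> a" "Th t \<noteq> b"
      using r(2) t Ga Gb by (auto simp: d_def)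
    then have i: "a < Th t" "Th t < b"
      using r by auto
    then have "at (Th t) within {a..b} = at (Th t)"
      by (intro at_within_interior) (auto simp: interior_atLeastAtMost_real)
    then have "(G has_real_derivative slowness mu (Th t)) (at (Th t))"
      using D r by metis
    moreover have "isCont Th t"
      using continuous_on_interior[OF contTh] t by (simp add: interior_atLeastAtMost_real)
    moreover have fs: "fast mu (Th t) * slowness mu (Th t) = 1"
      using fast_slowness steep r mu by auto
    ultimately have "(Th has_real_derivative inverse (slowness mu (Th t))) (at t)"
      using G_Th by (intro DERIV_inverse_function[of G _ Th t c d] t) auto
    moreover have "inverse (slowness mu (Th t)) = fast mu (Th t)"
      using fs by (metis inverse_unique mult.commute)
    ultimately show ?thesis
      by simp
  qed
  \<comment> \<open>Headings are chosen pointwise; integrability of the velocity comes from its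
    being the derivative of the position.\<close>
  have "\<exists>q. \<forall>t\<in>{c..d}. vel mu (q t) = fast mu (Th t) *\<^sub>R (- sin (Th t), cos (Th t))"
    by (rule bchoice) (use vel_of_tangential_speed mu steep Th_range in auto)
  then obtain q where q: "\<And>t. t \<in> {c..d} \<Longrightarrow> vel mu (q t) = fast mu (Th t) *\<^sub>R (- sin (Th t), cos (Th t))"
    by blast
  have Thc: "Th c = a" and Thd: "Th d = b"
    using Th_G[of a] Th_G[of b] Ga Gb ab by (auto simp: d_def)
  have "((\<lambda>s. vel mu (q s)) has_integral ((cos (Th t), sin (Th t)) - (cos a, sin a))) {c..t}"
    if t: "c \<le> t" "t \<le> d" for t
  proof -
    have "((\<lambda>s. vel mu (q s)) has_integral ((cos (Th t), sin (Th t)) - (cos (Th c), sin (Th c)))) {c..t}"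
    proof (rule fundamental_theorem_of_calculus_interior[OF t(1)])
      show "continuous_on {c..t} (\<lambda>s. (cos (Th s), sin (Th s)))"
        by (intro continuous_intros continuous_on_subset[OF contTh]) (use t in auto)
      fix s assume s: "s \<in> {c<..<t}"
      then have "((\<lambda>s. cos (Th s)) has_real_derivative fast mu (Th s) * - sin (Th s)) (at s)"
        "((\<lambda>s. sin (Th s)) has_real_derivative fast mu (Th s) * cos (Th s)) (at s)"
        using t by (auto intro!: derivative_eq_intros DTh)
      then show "((\<lambda>s. (cos (Th s), sin (Th s))) has_vector_derivative vel mu (q s)) (at s)"
        using q[of s] s t unfolding has_real_derivative_iff_has_vector_derivative
        by (auto intro!: has_vector_derivative_Pair)
    qed
    then show ?thesis
      by (simp add: Thc)
  qed
  then show ?thesis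
    using that[of Th q] Thd by (simp add: d_def)
qed

section \<open>Constraints on an arbitrary ride along the circle\<close>

lemma at_within_Icc_nontrivial:
  fixes a b t :: real
  assumes "a < b" "t \<in> {a..b}"
  shows "at t within {a..b} \<noteq> bot"
proof -
  have "\<nexists>c. {a..b} = {c}"
    using assms by (metis atLeastatMost_empty_iff2 atLeastAtMost_singleton_iff less_irrefl)
  then have "t islimpt {a..b}"
    using assms by (intro connected_imp_perfect) auto
  then show ?thesis
    by (simp add: trivial_limit_within)
qed

text \<open>The left side of the chord bound is a square, so the factor of
  \<open>(t - s)\<^sup>2\<close> on the right is nonnegative.\<close>

lemma chord_steep:
  assumes int: "(\<lambda>s. vel mu (psi s)) integrable_on {0..T}" and mu: "0 \<le> mu"
    and st: "0 \<le> s" "s < t" "t \<le> T"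
    and a: "traj mu x0 psi s = (cos a, sin a)" and b: "traj mu x0 psi t = (cos b, sin b)"
  shows "(cos ((a + b) / 2))\<^sup>2 \<le> mu\<^sup>2"
proof -
  have "0 \<le> (t - s)\<^sup>2 * (mu\<^sup>2 - (cos ((a + b) / 2))\<^sup>2)"
    using chord_speed_bound[OF int mu st(1) less_imp_le[OF st(2)] st(3) a b]
    by (rule order_trans[rotated]) simp
  then show ?thesis
    using st by (simp add: zero_le_mult_iff)
qed

text \<open>Let one end of a chord tend to the other: its mid-angle tends to
  \<open>th t\<close>.\<close>

lemma ride_steep:
  assumes int: "(\<lambda>s. vel mu (psi s)) integrable_on {0..T}" and mu: "0 \<le> mu"
    and ts: "0 \<le> ts" "ts < te" "te \<le> T"
    and cont: "continuous_on {ts..te} th"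
    and ride: "\<And>t. t \<in> {ts..te} \<Longrightarrow> traj mu x0 psi t = (cos (th t), sin (th t))"
    and t: "t \<in> {ts..te}"
  shows "(cos (th t))\<^sup>2 \<le> mu\<^sup>2"
proof -
  let ?F = "at t within {ts..te}"
  have "(th \<longlongrightarrow> th t) ?F"
    using cont t by (simp add: continuous_on_def)
  then have "((\<lambda>s. (cos ((th s + th t) / 2))\<^sup>2) \<longlongrightarrow> (cos ((th t + th t) / 2))\<^sup>2) ?F"
    by (intro tendsto_intros) auto
  moreover have "eventually (\<lambda>s. (cos ((th s + th t) / 2))\<^sup>2 \<le> mu\<^sup>2) ?F"
  proof -
    have "(cos ((th s + th t) / 2))\<^sup>2 \<le> mu\<^sup>2" if "s \<noteq> t" "s \<in> {ts..te}" for s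
    proof (cases "s < t")
      case True
      then show ?thesis
        by (rule chord_steep[OF int mu _ _ _ ride ride, rotated]) (use that t ts in auto)
    next
      case False
      then have "t < s"
        using that by simp
      then have "(cos ((th t + th s) / 2))\<^sup>2 \<le> mu\<^sup>2"
        by (rule chord_steep[OF int mu _ _ _ ride ride, rotated]) (use that t ts in auto)
      then show ?thesis
        by (simp add: add.commute)
    qed
    then show ?thesis
      unfolding eventually_at_filter by (intro always_eventually) blast
  qed
  ultimately have "(cos ((th t + th t) / 2))\<^sup>2 \<le> mu\<^sup>2"
    using at_within_Icc_nontrivial[OF ts(2) t] by (intro tendsto_upperbound)
  then show ?thesis
    by simp
qed

text \<open>At the angles 0 and \<open>pi\<close> the squared cosine is 1, above
  \<open>mu\<^sup>2\<close>, so by continuity the angle is trapped between them.\<close>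

lemma ride_range:
  assumes int: "(\<lambda>s. vel mu (psi s)) integrable_on {0..T}" and mu: "0 \<le> mu" "mu < 1"
    and ts: "0 \<le> ts" "ts < te" "te \<le> T"
    and cont: "continuous_on {ts..te} th"
    and ride: "\<And>t. t \<in> {ts..te} \<Longrightarrow> traj mu x0 psi t = (cos (th t), sin (th t))"
    and start: "0 < th ts" "th ts < pi"
    and t: "t \<in> {ts..te}"
  shows "0 < th t" "th t < pi"
proof -
  have "mu\<^sup>2 < 1"
    using mu by (simp add: power_less_one_iff)
  then have ne: "th s \<noteq> 0 \<and> th s \<noteq> pi" if "s \<in> {ts..te}" for s
    using ride_steep[OF int mu(1) ts cont ride that] by auto
  have cont': "continuous_on {ts..t} th"
    by (rule continuous_on_subset[OF cont]) (use t in auto)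
  show "0 < th t"
  proof (rule ccontr)
    assume "\<not> ?thesis"
    then obtain s where "ts \<le> s" "s \<le> t" "th s = 0"
      using IVT2'[of th t 0 ts, OF _ _ _ cont'] start t by auto
    then show False
      using ne[of s] t by auto
  qed
  show "th t < pi"
  proof (rule ccontr)
    assume "\<not> ?thesis"
    then obtain s where "ts \<le> s" "s \<le> t" "th s = pi"
      using IVT'[of th ts pi t, OF _ _ _ cont'] start t by auto
    then show False
      using ne[of s] t by auto
  qed
qed

text \<open>As \<open>mu < 1\<close>, the drift wins: the first coordinate strictly decreases, and
  \<open>cos\<close> is decreasing on \<open>[0, pi]\<close>.\<close>

lemma ride_strict_mono:
  assumes int: "(\<lambda>s. vel mu (psi s)) integrable_on {0..T}" and mu: "0 \<le> mu" "mu < 1"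
    and st: "0 \<le> s" "s < t" "t \<le> T"
    and ab: "0 \<le> b" "a \<le> pi"
    and a: "traj mu x0 psi s = (cos a, sin a)" and b: "traj mu x0 psi t = (cos b, sin b)"
  shows "a < b"
proof (rule ccontr)
  assume "\<not> ?thesis"
  then have "cos a \<le> cos b"
    using ab by (intro cos_monotone_0_pi_le) auto
  moreover have "\<bar>cos b - cos a + (t - s)\<bar> \<le> mu * (t - s)"
    using order_trans[OF norm_fst_le[of "cos b - cos a + (t - s)" "sin b - sin a"], of "mu * (t - s)"]
      traj_increment_bound[OF int st(1) less_imp_le[OF st(2)] st(3) mu(1), of x0]
    by (simp add: a b)
  moreover have "mu * (t - s) < t - s"
    using mu st by simp
  ultimately show False
    using st by linarith
qed

text \<open>The angle is given only as a continuous function of time, so the speed bound is used on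
  chords instead of derivatives. On short arcs the chord bound and the mean value theorem for
  \<open>t_arc\<close> agree up to a small error.\<close>

lemma ride_time_ge_t_arc:
  assumes int: "(\<lambda>s. vel mu (psi s)) integrable_on {0..T}" and mu: "0 < mu" "mu < 1"
    and ts: "0 \<le> ts" "ts < te" "te \<le> T"
    and cont: "continuous_on {ts..te} th"
    and ride: "\<And>t. t \<in> {ts..te} \<Longrightarrow> traj mu x0 psi t = (cos (th t), sin (th t))"
    and start: "0 < th ts" "th ts < pi"
  shows "t_arc mu (th ts) (th te) \<le> te - ts"
proof -
  let ?A = "t_arc mu (th ts)"
  have range: "0 < th t" "th t < pi" if "t \<in> {ts..te}" for t
    using ride_range[of mu psi T ts te th x0 t] int mu ts cont ride start that by auto
  have mono: "th s < th t" if "s \<in> {ts..te}" "s < t" "t \<in> {ts..te}" for s t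
    by (rule ride_strict_mono[OF int _ mu(2) _ that(2) _ _ _ ride ride])
      (use that ts mu range[of s] range[of t] in auto)
  have mu2: "1 - mu\<^sup>2 > 0"
    using mu by (simp add: power_less_one_iff)
  \<comment> \<open>The error is proportional to the swept angle, hence additive when intervals are
    joined, as bisection requires.\<close>
  have eps: "?A (th te) - ?A (th ts) \<le> (te - ts) + e * (th te - th ts)" if e: "e > 0" for e
  proof -
    have "ts \<le> ts \<and> te \<le> te \<longrightarrow> ?A (th te) - ?A (th ts) \<le> (te - ts) + e * (th te - th ts)"
    proof (rule Bolzano[OF less_imp_le[OF ts(2)], of "\<lambda>s t. ts \<le> s \<and> t \<le> te \<longrightarrow>
        ?A (th t) - ?A (th s) \<le> (t - s) + e * (th t - th s)"])
      fix a b c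
      assume "ts \<le> a \<and> b \<le> te \<longrightarrow> ?A (th b) - ?A (th a) \<le> (b - a) + e * (th b - th a)"
        and "ts \<le> b \<and> c \<le> te \<longrightarrow> ?A (th c) - ?A (th b) \<le> (c - b) + e * (th c - th b)"
        and "a \<le> b" "b \<le> c"
      then show "ts \<le> a \<and> c \<le> te \<longrightarrow> ?A (th c) - ?A (th a) \<le> (c - a) + e * (th c - th a)"
        by (auto simp: algebra_simps)
    next
      fix y assume y: "ts \<le> y" "y \<le> te"
      \<comment> \<open>Two comparisons with \<open>th y\<close>, each within \<open>e / 4\<close>,
        bound the change of \<open>slowness\<close> between two points of a short arc by
        \<open>e / 2\<close>.\<close>
      have "isCont (slowness mu) (th y)"
        using continuous_on_slowness[of UNIV mu] by (simp add: continuous_on_eq_continuous_at)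
      then obtain k1 where k1: "k1 > 0"
        "\<And>v. \<bar>v - th y\<bar> < k1 \<Longrightarrow> \<bar>slowness mu v - slowness mu (th y)\<bar> < e / 4"
        using e unfolding continuous_at_eps_delta dist_real_def by (metis zero_less_divide_iff zero_less_numeral)
      have "isCont (cos :: real \<Rightarrow> real) 0"
        by simp
      \<comment> \<open>This tolerance becomes \<open>e / 2\<close> when multiplied by the bound
        \<open>1 / (1 - mu\<^sup>2)\<close> on \<open>slowness\<close>.\<close>
      moreover have "e * (1 - mu\<^sup>2) / 2 > 0"
        using e mu2 by simp
      ultimately obtain k2 where k2: "k2 > 0"
        "\<And>v. \<bar>v\<bar> < k2 \<Longrightarrow> \<bar>cos v - 1\<bar> < e * (1 - mu\<^sup>2) / 2"
        unfolding continuous_at_eps_delta dist_real_def by (metis cos_zero diff_zero)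
      define k where "k = min k1 k2"
      have "k > 0"
        using k1 k2 by (simp add: k_def)
      then obtain d where d: "d > 0" "\<And>t. t \<in> {ts..te} \<Longrightarrow> \<bar>t - y\<bar> < d \<Longrightarrow> \<bar>th t - th y\<bar> < k"
        using cont y unfolding continuous_on_iff dist_real_def by (metis atLeastAtMost_iff)
      have "?A (th t) - ?A (th s) \<le> (t - s) + e * (th t - th s)"
        if st: "s \<le> y" "y \<le> t" "t - s < d" "ts \<le> s" "t \<le> te" for s t
      proof (cases "s = t")
        case False
        define a b m h where "a = th s" and "b = th t" and "m = (a + b) / 2" and "h = t - s"
        have S: "s \<in> {ts..te}" "t \<in> {ts..te}" "s < t"
          using st False by auto
        have ab: "a < b"
          using mono S by (simp add: a_def b_def)
        have near: "\<bar>a - th y\<bar> < k" "\<bar>b - th y\<bar> < k"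
          using d(2)[of s] d(2)[of t] S st by (auto simp: a_def b_def)
        have "th ts \<le> a"
          using mono[of ts s] S by (cases "s = ts") (auto simp: a_def)
        then obtain z where z: "a < z" "z < b" "?A b - ?A a = (b - a) * slowness mu z"
          using t_arc_MVT[OF mu _ ab] by metis
        have m: "a < m" "m < b"
          using ab by (auto simp: m_def)
        have slow_diff: "slowness mu z \<le> slowness mu m + e / 2"
        proof -
          have "\<bar>z - th y\<bar> < k1" "\<bar>m - th y\<bar> < k1"
            using near z(1,2) m unfolding k_def by linarith+
          then show ?thesis
            using k1(2)[of z] k1(2)[of m] e by linarith
        qed
        have steep: "(cos m)\<^sup>2 \<le> mu\<^sup>2"
          unfolding m_def a_def b_def
          by (rule chord_steep[OF int _ _ S(3) _ ride ride]) (use S ts mu in auto)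
        have "0 < m" "m < pi"
          using m range[OF S(1)] range[OF S(2)] by (auto simp: a_def b_def)
        then have slow_pos: "slowness mu m > 0"
          using mu by (intro slowness_pos sin_gt_zero) auto
        \<comment> \<open>\<open>cos r\<close> is the ratio of the chord
          \<open>2 * sin ((b - a) / 2)\<close> to the arc \<open>b - a\<close>, close to 1 on short
          arcs.\<close>
        obtain r where r: "0 < r" "r < (b - a) / 2"
          "sin ((b - a) / 2) - sin 0 = ((b - a) / 2 - 0) * cos r"
          using MVT2[of 0 "(b - a) / 2" sin cos] ab by (auto intro: DERIV_sin)
        have "\<bar>r\<bar> < k2"
          using r near by (auto simp: k_def)
        then have cos_r: "1 - cos r \<le> e * (1 - mu\<^sup>2) / 2"
          using k2(2)[of r] by simp
        have sin_r: "2 * sin ((b - a) / 2) = (b - a) * cos r"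
          using r(3) by simp
        have "(2 * sin ((b - a) / 2) - h * sin m)\<^sup>2 \<le> h\<^sup>2 * (mu\<^sup>2 - (cos m)\<^sup>2)"
          unfolding m_def a_def b_def h_def
          by (rule chord_speed_bound[OF int _ _ _ _ ride ride]) (use S ts mu in auto)
        then have "\<bar>2 * sin ((b - a) / 2) - h * sin m\<bar> \<le> sqrt (h\<^sup>2 * (mu\<^sup>2 - (cos m)\<^sup>2))"
          by (metis real_sqrt_abs real_sqrt_le_mono)
        also have "\<dots> = h * sqrt (mu\<^sup>2 - (cos m)\<^sup>2)"
          using S by (simp add: real_sqrt_mult h_def)
        finally have "(b - a) * cos r \<le> h * fast mu m"
          using sin_r by (simp add: fast_def algebra_simps)
        \<comment> \<open>Multiplication by \<open>slowness\<close> turns the speed bound into a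
          lower bound on the time \<open>h\<close>.\<close>
        then have "(b - a) * cos r * slowness mu m \<le> h * fast mu m * slowness mu m"
          using slow_pos by (intro mult_right_mono) auto
        also have "\<dots> = h"
          using fast_slowness[OF mu steep] by simp
        finally have 1: "(b - a) * cos r * slowness mu m \<le> h" .
        have "(1 - cos r) * slowness mu m \<le> e * (1 - mu\<^sup>2) / 2 * (1 / (1 - mu\<^sup>2))"
          using cos_r slow_pos slowness_le[OF mu steep] e mu2 by (intro mult_mono) auto
        also have "\<dots> = e / 2"
          using mu2 by (simp add: field_simps)
        finally have "(1 - cos r) * slowness mu m \<le> e / 2" .
        then have "slowness mu z \<le> cos r * slowness mu m + e"
          using slow_diff by (simp add: algebra_simps)
        then have "(b - a) * slowness mu z \<le> (b - a) * (cos r * slowness mu m + e)"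
          using ab by (intro mult_left_mono) auto
        then show ?thesis
          using 1 z(3) unfolding a_def[symmetric] b_def[symmetric] h_def[symmetric]
          by (simp add: algebra_simps)
      qed simp
      then show "\<exists>d>0. \<forall>s t. s \<le> y \<and> y \<le> t \<and> t - s < d \<longrightarrow> ts \<le> s \<and> t \<le> te \<longrightarrow>
          ?A (th t) - ?A (th s) \<le> (t - s) + e * (th t - th s)"
        using d(1) by blast
    qed
    then show ?thesis
      by simp
  qed
  have "th te - th ts > 0"
    using mono[of ts te] ts by simp
  show ?thesis
  proof (rule field_le_epsilon)
    fix e :: real assume "e > 0"
    then show "?A (th te) \<le> te - ts + e"
      using eps[of "e / (th te - th ts)"] \<open>th te - th ts > 0\<close> by (simp add: t_arc_self)
  qed
qed

section \<open>The exit angle\<close>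

text \<open>In the equation of the straight tail both \<open>?x T\<close> and the Evader's own
  motion are multiples of \<open>u\<close>; collecting them leaves the vector whose angle
  \<open>psi_of\<close> takes when the remaining time is \<open>T - te\<close>.\<close>

lemma exit_heading:
  assumes opt: "optimal mu x0 T psi" and mu: "0 < mu" "mu < 1"
    and te: "0 \<le> te" "te < T"
    and leave: "\<forall>t\<in>{te<..T}. norm (traj mu x0 psi t) > 1"
    and u: "u = traj mu x0 psi T /\<^sub>R norm (traj mu x0 psi T)"
    and p: "traj mu x0 psi te = (cos th, sin th)" "sin th > 0" "(cos th)\<^sup>2 \<le> mu\<^sup>2"
  obtains N where "N > 0" "(cos th - (T - te), sin th) = N *\<^sub>R u" "fst u < mu"
proof -
  let ?x = "traj mu x0 psi"
  have nT: "norm (?x T) > 1"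
    using leave te by auto
  define N where "N = norm (?x T) - mu * (T - te)"
  have "?x T \<noteq> 0"
    using nT by auto
  then have nu: "norm u = 1" and xT: "?x T = norm (?x T) *\<^sub>R u"
    by (simp_all add: u)
  have up: "snd u > 0"
    using exit_heading_upward[OF opt mu te leave u] p by simp
  have "norm (?x T) *\<^sub>R u = (cos th, sin th) + (T - te) *\<^sub>R (mu *\<^sub>R u - (1, 0))"
    using tail_straight[OF opt less_imp_le[OF mu(1)] mu(2) te leave u, of T] te xT p by simp
  then have eq: "(cos th - (T - te), sin th) = N *\<^sub>R u"
    by (cases u) (simp add: N_def algebra_simps)
  then have fu: "cos th - (T - te) = N * fst u" and su: "sin th = N * snd u"
    by (metis fst_conv fst_scaleR real_scaleR_def, metis snd_conv snd_scaleR real_scaleR_def)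
  have N: "N > 0"
    using p(2) up unfolding su by (simp add: zero_less_mult_iff)
  have uu: "(fst u)\<^sup>2 + (snd u)\<^sup>2 = 1"
    using nu by (cases u) (simp add: norm_Pair)
  \<comment> \<open>Otherwise \<open>0 < N * fst u < cos th\<close>, which forces
    \<open>N < 1\<close>; then \<open>(sin th)\<^sup>2 = N\<^sup>2 * (1 - (fst u)\<^sup>2)\<close>
    is below \<open>1 - mu\<^sup>2\<close>, against the bound on \<open>cos th\<close>.\<close>
  have "fst u < mu"
  proof (rule ccontr)
    assume "\<not> ?thesis"
    then have ge: "mu \<le> fst u"
      by simp
    then have "N * fst u > 0"
      using N mu by simp
    then have "(N * fst u)\<^sup>2 < (cos th)\<^sup>2"
      using fu te by (intro power_strict_mono) auto
    moreover have "N\<^sup>2 = (N * fst u)\<^sup>2 + (sin th)\<^sup>2"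
      using uu unfolding su by (simp add: power_mult_distrib flip: distrib_left)
    ultimately have "N\<^sup>2 < 1"
      by (simp add: sin_squared_eq)
    have "mu\<^sup>2 < 1" "mu\<^sup>2 \<le> (fst u)\<^sup>2"
      using mu ge by (auto simp: power_less_one_iff intro: power_mono)
    have "(sin th)\<^sup>2 = N\<^sup>2 * (1 - (fst u)\<^sup>2)"
      using uu unfolding su by (simp add: power_mult_distrib)
    also have "\<dots> \<le> N\<^sup>2 * (1 - mu\<^sup>2)"
      using \<open>mu\<^sup>2 \<le> (fst u)\<^sup>2\<close> by (intro mult_left_mono) auto
    also have "\<dots> < 1 - mu\<^sup>2"
      using \<open>N\<^sup>2 < 1\<close> \<open>mu\<^sup>2 < 1\<close> by simp
    finally show False
      using p(3) by (simp add: sin_squared_eq)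
  qed
  then show ?thesis
    using that N eq by blast
qed

text \<open>Since \<open>fst u < mu\<close>, every unit of time saved on the circle can be spent along u,
  which increases the distance; so the ride takes the least possible time.\<close>

lemma ride_time_eq_t_arc:
  assumes opt: "optimal mu x0 T psi" and mu: "0 < mu" "mu < 1"
    and ts: "0 \<le> ts" "ts < te" "te < T"
    and cont: "continuous_on {ts..te} th"
    and ride: "\<And>t. t \<in> {ts..te} \<Longrightarrow> traj mu x0 psi t = (cos (th t), sin (th t))"
    and start: "0 < th ts" "th ts < pi"
    and leave: "\<forall>t\<in>{te<..T}. norm (traj mu x0 psi t) > 1"
    and u: "u = traj mu x0 psi T /\<^sub>R norm (traj mu x0 psi T)"
    and tangent: "traj mu x0 psi te \<bullet> (mu *\<^sub>R u - (1, 0)) = 0"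
    and fst_u: "fst u < mu"
  shows "t_arc mu (th ts) (th te) = te - ts"
proof (rule ccontr)
  let ?x = "traj mu x0 psi" and ?w = "mu *\<^sub>R u - (1, 0)"
  note int = optimal_integrable[OF opt]
  have te': "te \<le> T"
    using ts by simp
  define tau where "tau = t_arc mu (th ts) (th te)"
  have range: "0 < th t" "th t < pi" if "t \<in> {ts..te}" for t
    using ride_range[of mu psi T ts te th x0 t] int mu ts cont ride start that by auto
  have less: "th ts < th te"
    by (rule ride_strict_mono[OF int _ mu(2) ts(1,2) te' _ _ ride ride])
      (use ts mu range[of ts] range[of te] in auto)
  \<comment> \<open>Every angle in between is attained during the given ride, so its steepness bound
    carries over to the fast ride.\<close>
  have steep: "(cos v)\<^sup>2 \<le> mu\<^sup>2" if v: "th ts \<le> v" "v \<le> th te" for v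
  proof -
    obtain t where "ts \<le> t" "t \<le> te" "th t = v"
      using IVT'[of th ts v te, OF v _ cont] ts by auto
    then show ?thesis
      using ride_steep[OF int less_imp_le[OF mu(1)] ts(1,2) te' cont ride, of t] by auto
  qed
  assume "t_arc mu (th ts) (th te) \<noteq> te - ts"
  then have tau: "tau < te - ts"
    using ride_time_ge_t_arc[OF int mu ts(1,2) te' cont ride start] by (simp add: tau_def)
  have less_pi: "th te < pi"
    using range(2)[of te] ts by simp
  have "\<exists>q Th. Th (ts + tau) = th te \<and> (\<forall>t. ts \<le> t \<longrightarrow> t \<le> ts + tau \<longrightarrow>
       ((\<lambda>s. vel mu (q s)) has_integral ((cos (Th t), sin (Th t)) - (cos (th ts), sin (th ts)))) {ts..t})"
    unfolding tau_def
  proof (rule fast_ride_exists[OF mu start(1) less less_pi, where c = ts])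
    show "(cos v)\<^sup>2 \<le> mu\<^sup>2" if "th ts \<le> v" "v \<le> th te" for v
      using that by (rule steep)
  qed blast
  then obtain q Th where Th: "Th (ts + tau) = th te"
    and ride_q: "\<And>t. ts \<le> t \<Longrightarrow> t \<le> ts + tau \<Longrightarrow>
       ((\<lambda>s. vel mu (q s)) has_integral ((cos (Th t), sin (Th t)) - (cos (th ts), sin (th ts)))) {ts..t}"
    by blast
  have "0 \<le> slowness mu v" if "v \<in> {th ts..th te}" for v
    using that start less_pi by (intro less_imp_le[OF slowness_pos[OF mu]] sin_gt_zero) auto
  then have tau0: "0 \<le> tau"
    unfolding tau_def t_arc_eq_integral[OF mu less_imp_le[OF less]]
    by (intro integral_nonneg integrable_continuous_real continuous_on_slowness)
  have nT: "norm (?x T) > 1"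
    using leave ts by auto
  then have nz: "?x T \<noteq> 0"
    by auto
  then have nu: "norm u = 1"
    by (simp add: u)
  obtain p where p: "u = (cos p, sin p)"
    using unit_vector_angle[OF nu] .
  have w: "vel mu p = ?w"
    by (simp add: vel_eq p)
  define b where "b = ts + tau"
  have b: "ts \<le> b" "b < te" "b < T"
    using tau tau0 ts by (auto simp: b_def)
  \<comment> \<open>The competitor: the old approach, the ride at full speed ending at
    \<open>b\<close>, then heading \<open>u\<close> until \<open>T\<close>.\<close>
  define psi' where "psi' = switch ts psi (switch b q (\<lambda>_. p))"
  have int0: "(\<lambda>s. vel mu (psi s)) integrable_on {0..ts}"
    using integrable_on_subinterval[OF int] ts by auto
  have xs: "?x ts = (cos (th ts), sin (th ts))" and xe: "?x te = (cos (th te), sin (th te))"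
    using ride ts by auto
  have h1: "((\<lambda>s. vel mu (switch b q (\<lambda>_. p) s)) has_integral ((cos (Th t), sin (Th t)) - ?x ts)) {ts..t}"
    if "ts \<le> t" "t \<le> b" for t
    using ride_q[of t] that unfolding xs b_def[symmetric]
    by (auto intro: has_integral_eq[rotated] simp: switch_def)
  have h2: "((\<lambda>s. vel mu (switch b q (\<lambda>_. p) s)) has_integral ((?x te - ?x ts) + (t - b) *\<^sub>R ?w)) {ts..t}"
    if "b \<le> t" for t
  proof (rule has_integral_combine[OF b(1) that])
    show "((\<lambda>s. vel mu (switch b q (\<lambda>_. p) s)) has_integral (?x te - ?x ts)) {ts..b}"
      using h1[OF b(1) order_refl] Th xe by (simp add: b_def)
    show "((\<lambda>s. vel mu (switch b q (\<lambda>_. p) s)) has_integral (t - b) *\<^sub>R ?w) {b..t}"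
      by (rule vel_switch_after_has_integral) (use vel_const_has_integral[OF that, of mu p] w in simp)
  qed
  have x1: "traj mu x0 psi' t = (cos (Th t), sin (Th t))" if "ts \<le> t" "t \<le> b" for t
    using traj_switch_after[OF ts(1) that(1) int0 h1[OF that]] by (simp add: psi'_def)
  have x2: "traj mu x0 psi' t = ?x te + (t - b) *\<^sub>R ?w" if "b \<le> t" for t
    using traj_switch_after[OF ts(1) _ int0 h2[OF that], of x0] b that by (simp add: psi'_def)
  have "admissible mu x0 T psi'"
    unfolding admissible_def
  proof (intro conjI ballI)
    show "(\<lambda>s. vel mu (psi' s)) integrable_on {0..T}"
      using vel_switch_has_integral[OF ts(1) _ int0 h2[OF less_imp_le[OF b(3)]]] b
      unfolding psi'_def has_integral_integrable_integral by simp
    fix t assume t: "t \<in> {0..T}"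
    consider "t \<le> ts" | "ts \<le> t" "t \<le> b" | "b \<le> t" by linarith
    then show "1 \<le> norm (traj mu x0 psi' t)"
    proof cases
      case 1
      then show ?thesis
        using opt t by (simp add: psi'_def traj_switch_before optimal_def admissible_def)
    next
      case 2
      then show ?thesis
        using x1 by simp
    next
      case 3
      \<comment> \<open>By tangency the ray is orthogonal to the radius at the exit point, so it
        stays outside the disc.\<close>
      have "(norm (?x te + (t - b) *\<^sub>R ?w))\<^sup>2 = (norm (?x te))\<^sup>2 + (norm ((t - b) *\<^sub>R ?w))\<^sup>2"
        using tangent by (intro norm_add_Pythagorean) (simp add: orthogonal_def del: scaleR_right_diff_distrib)
      then have "1 \<le> (norm (?x te + (t - b) *\<^sub>R ?w))\<^sup>2"
        using xe by simp
      then show ?thesis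
        unfolding x2[OF 3] by (rule power2_le_imp_le[of 1, OF _ norm_ge_zero, unfolded power_one])
    qed
  qed
  from optimalD[OF opt this] have le: "norm (traj mu x0 psi' T) \<le> norm (?x T)" .
  \<comment> \<open>The saved time \<open>te - b\<close> shifts the final position along
    \<open>?w\<close>, whose \<open>u\<close>-component \<open>mu - fst u\<close> is
    positive.\<close>
  have "traj mu x0 psi' T = ?x te + ((T - te) *\<^sub>R ?w + (te - b) *\<^sub>R ?w)"
    unfolding x2[OF less_imp_le[OF b(3)]] by (simp flip: scaleR_left_distrib)
  also have "\<dots> = ?x T + (te - b) *\<^sub>R ?w"
    using tail_straight[OF opt less_imp_le[OF mu(1)] mu(2) _ ts(3) leave u, of T] ts by (simp del: scaleR_right_diff_distrib)
  finally have xT: "traj mu x0 psi' T = ?x T + (te - b) *\<^sub>R ?w" .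
  have "u \<bullet> ?x T = norm (?x T)"
    using nz by (simp add: u dot_square_norm power2_eq_square)
  moreover have "u \<bullet> ?w = mu * (u \<bullet> u) - u \<bullet> (1, 0)"
    by (simp only: inner_diff_right inner_scaleR_right)
  then have "u \<bullet> ?w = mu - fst u"
    using nu by (cases u) (simp add: norm_eq_1)
  ultimately have "u \<bullet> traj mu x0 psi' T = norm (?x T) + (te - b) * (mu - fst u)"
    unfolding xT by (simp add: inner_add_right del: scaleR_right_diff_distrib inner_diff_right)
  moreover have "(te - b) * (mu - fst u) > 0"
    using b fst_u by simp
  moreover have "u \<bullet> traj mu x0 psi' T \<le> norm (traj mu x0 psi' T)"
    using norm_cauchy_schwarz[of u "traj mu x0 psi' T"] nu by simp
  ultimately show False
    using le by simp
qed

section \<open>Polar angles and the tangent point\<close>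

lemma atan2_scaled_angle:
  assumes "r > 0" "- pi < a" "a \<le> pi"
  shows "atan2 (r * sin a) (r * cos a) = a"
  unfolding atan2_def using assms
  by (intro Arg_unique'[of r]) (auto simp: rcis_def cis.ctr complex_eq_iff)

lemma cos_sin_atan2:
  assumes "norm u = 1" "N > 0"
  shows "(cos (atan2 (N * snd u) (N * fst u)), sin (atan2 (N * snd u) (N * fst u))) = u"
proof -
  let ?z = "Complex (N * fst u) (N * snd u)"
  have "cmod ?z = N"
    using assms by (cases u) (simp add: cmod_def norm_Pair power_mult_distrib real_sqrt_mult flip: distrib_left)
  then have "rcis N (Arg ?z) = ?z"
    using rcis_cmod_Arg[of ?z] by simp
  then have "N * cos (Arg ?z) = N * fst u" "N * sin (Arg ?z) = N * snd u"
    by (simp_all add: complex_eq_iff)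
  then show ?thesis
    using assms by (cases u) (simp add: atan2_def)
qed

lemma arccos_acute:
  fixes k :: real
  assumes "0 < k" "k < 1"
  shows "0 < arccos k" "arccos k < pi / 2"
  using arccos_lt_bounded[of k] arccos_less_arccos[of 0 k] assms by simp_all

lemma theta_tan_bounds:
  assumes "norm x0 > 1" "snd x0 \<ge> 0"
  shows "0 < theta_tan x0" "theta_tan x0 < 3 * pi / 2"
proof -
  have "0 \<le> atan2 (snd x0) (fst x0)" "atan2 (snd x0) (fst x0) \<le> pi"
    using assms by (simp_all add: atan2_def Arg_less_0 Arg_le_pi)
  moreover have "0 < 1 / norm x0" "1 / norm x0 < 1"
    using assms(1) less_trans[OF zero_less_one assms(1)] by (simp_all only: zero_less_divide_1_iff divide_less_eq_1_pos)
  then have "0 < arccos (1 / norm x0)" "arccos (1 / norm x0) < pi / 2"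
    by (rule arccos_acute)+
  ultimately show "0 < theta_tan x0" "theta_tan x0 < 3 * pi / 2"
    by (auto simp: theta_tan_def)
qed

text \<open>As \<open>phi_tan x0 = theta_tan x0 + pi / 2\<close>, the denominator of
  \<open>t_tan\<close> is \<open>fast mu (theta_tan x0)\<close>. The root in it lies below the
  absolute value of the sine, so a positive \<open>t_tan\<close> makes the sine positive.\<close>

lemma theta_tan_in_upper_half_plane:
  assumes mu: "0 < mu" "mu < 1" and x0: "norm x0 > 1" "snd x0 \<ge> 0"
    and pos: "t_tan mu x0 > 0" and steep: "(cos (theta_tan x0))\<^sup>2 \<le> mu\<^sup>2"
  shows "0 < theta_tan x0" "theta_tan x0 < pi"
proof -
  let ?th = "theta_tan x0"
  have mu2: "mu\<^sup>2 < 1"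
    using mu by (simp add: power_less_one_iff)
  have "0 < 1 / norm x0" "1 / norm x0 < 1"
    using x0(1) less_trans[OF zero_less_one x0(1)] by (simp_all only: zero_less_divide_1_iff divide_less_eq_1_pos)
  then have "arcsin (1 / norm x0) + arccos (1 / norm x0) = pi / 2"
    by (intro arcsin_plus_arccos) linarith+
  then have phi: "phi_tan x0 = ?th + pi / 2"
    unfolding phi_tan_def theta_tan_def by linarith
  have "sqrt ((norm x0)\<^sup>2 - 1) > 0"
    using x0 by (simp add: one_less_power)
  then have "sin ?th + sqrt (mu\<^sup>2 - (cos ?th)\<^sup>2) > 0"
    using pos unfolding t_tan_def phi by (simp add: cos_add sin_add zero_less_divide_iff)
  moreover have "sqrt (mu\<^sup>2 - (cos ?th)\<^sup>2) < sqrt ((sin ?th)\<^sup>2)"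
    using mu2 by (intro real_sqrt_less_mono) (simp add: sin_squared_eq)
  ultimately have s: "sin ?th > 0"
    by (auto simp: abs_if split: if_splits)
  show "0 < ?th"
    using theta_tan_bounds x0 by simp
  show "?th < pi"
  proof (rule ccontr)
    assume "\<not> ?thesis"
    then have "0 \<le> sin (?th - pi)"
      using theta_tan_bounds[OF x0] by (intro sin_ge_zero) auto
    then show False
      using s by simp
  qed
qed

theorem theorem2:
  fixes mu T t_exit theta_exit :: real and x0 :: "real \<times> real" and psi :: "real \<Rightarrow> real"
  assumes mu: "0 < mu" "mu < 1"
    and x0: "norm x0 > 1" "snd x0 \<ge> 0"
    and opt: "optimal mu x0 T psi"
    and times: "t_tan mu x0 < t_exit" "t_exit < T"
    and straight: "\<forall>t\<in>{0..t_tan mu x0}. traj mu x0 psi t =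
         x0 + (t / t_tan mu x0) *\<^sub>R ((cos (theta_tan x0), sin (theta_tan x0)) - x0)"
    and ride: "\<exists>th. continuous_on {t_tan mu x0..t_exit} th \<and>
         th (t_tan mu x0) = theta_tan x0 \<and> th t_exit = theta_exit \<and>
         (\<forall>t\<in>{t_tan mu x0..t_exit}. traj mu x0 psi t = (cos (th t), sin (th t)))"
    and leave: "\<forall>t\<in>{t_exit<..T}. norm (traj mu x0 psi t) > 1"
  shows "atan2 (mu * sin (psi_of mu x0 T theta_exit)) (mu * cos (psi_of mu x0 T theta_exit) - 1)
           - theta_exit = pi / 2"
proof -
  let ?x = "traj mu x0 psi" and ?ts = "t_tan mu x0" and ?te = t_exit
  note int = optimal_integrable[OF opt]
  obtain th where cont: "continuous_on {?ts..?te} th"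
    and th: "th ?ts = theta_tan x0" "th ?te = theta_exit"
    and xr: "\<And>t. t \<in> {?ts..?te} \<Longrightarrow> ?x t = (cos (th t), sin (th t))"
    using ride by blast
  have ts: "?ts > 0"
  proof (rule ccontr)
    \<comment> \<open>For \<open>?ts \<le> 0\<close> the integral in \<open>traj\<close> runs over
      an empty or one-point interval, so the path would still be at \<open>x0\<close>, off the
      circle.\<close>
    assume "\<not> ?thesis"
    then have "{0..?ts} = {} \<or> ?ts = 0"
      by auto
    then have "?x ?ts = x0"
      by (auto simp: traj_def)
    then show False
      using xr[of ?ts] x0 times norm_cos_sin[of "th ?ts"] by simp
  qed
  have steep: "(cos (th t))\<^sup>2 \<le> mu\<^sup>2" if "t \<in> {?ts..?te}" for t
    using ride_steep[of mu psi T ?ts ?te th x0 t] int mu ts times cont xr that by auto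
  have start: "0 < th ?ts" "th ?ts < pi"
    using theta_tan_in_upper_half_plane[OF mu x0 ts] steep[of ?ts] times th by auto
  have range: "0 < theta_exit" "theta_exit < pi"
    using ride_range[of mu psi T ?ts ?te th x0 ?te] int mu ts times cont xr start th by auto
  define u where "u = ?x T /\<^sub>R norm (?x T)"
  have "norm (?x T) > 1"
    using leave times by auto
  then have "?x T \<noteq> 0"
    by auto
  then have nu: "norm u = 1"
    by (simp add: u_def)
  have p: "?x ?te = (cos theta_exit, sin theta_exit)"
    using xr[of ?te] times th by simp
  have sin_pos: "sin theta_exit > 0"
    using range by (rule sin_gt_zero)
  have te: "0 \<le> ?te" and steep_exit: "(cos theta_exit)\<^sup>2 \<le> mu\<^sup>2"
    using ts times steep[of ?te] th by auto
  obtain N where N: "N > 0" "(cos theta_exit - (T - ?te), sin theta_exit) = N *\<^sub>R u" "fst u < mu"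
    by (rule exit_heading[OF opt mu te times(2) leave u_def p sin_pos steep_exit])
  have tangent: "?x ?te \<bullet> (mu *\<^sub>R u - (1, 0)) = 0"
    by (rule exit_tangential[OF opt less_imp_le[OF mu(1)] mu(2) less_imp_le[OF ts] times _ leave u_def])
      (use xr in auto)
  have "t_arc mu (th ?ts) (th ?te) = ?te - ?ts"
    by (rule ride_time_eq_t_arc[OF opt mu less_imp_le[OF ts] times cont xr start leave u_def tangent N(3)])
  \<comment> \<open>The nominal remaining time is the true one, so \<open>psi_of\<close> yields the
    direction of \<open>u\<close>.\<close>
  then have tr: "t_r mu x0 T theta_exit = T - ?te"
    by (simp add: t_r_def th)
  have N': "cos theta_exit - (T - ?te) = N * fst u" "sin theta_exit = N * snd u"
    using N(2) by (metis fst_conv fst_scaleR real_scaleR_def, metis snd_conv snd_scaleR real_scaleR_def)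
  have u_psi: "(cos (psi_of mu x0 T theta_exit), sin (psi_of mu x0 T theta_exit)) = u"
    unfolding psi_of_def tr N' by (rule cos_sin_atan2[OF nu N(1)])
  have su: "snd u > 0"
    using N'(2) N(1) sin_pos by (simp add: zero_less_mult_iff)
  have tang: "cos theta_exit * (mu * fst u - 1) + sin theta_exit * (mu * snd u) = 0"
    using tangent p by (cases u) simp
  have "mu * fst u < 1"
    using N(3) mu by (smt (verit) mult_less_cancel_left_pos mult_le_one)
  \<comment> \<open>Tangency equates \<open>cos theta_exit * (1 - mu * fst u)\<close> with the
    positive \<open>sin theta_exit * (mu * snd u)\<close>.\<close>
  have cpos: "cos theta_exit > 0"
  proof -
    have "sin theta_exit * (mu * snd u) > 0"
      using su mu sin_pos by simp
    then have "cos theta_exit * (1 - mu * fst u) > 0"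
      using tang by (simp add: algebra_simps)
    then show ?thesis
      using \<open>mu * fst u < 1\<close> by (simp add: zero_less_mult_iff)
  qed
  \<comment> \<open>This places \<open>theta_exit + pi / 2\<close> in the range of
    \<open>Arg\<close>, so the final equation holds without a multiple of
    \<open>2 * pi\<close>.\<close>
  have le: "theta_exit < pi / 2"
  proof (rule ccontr)
    assume "\<not> ?thesis"
    then have "cos theta_exit \<le> cos (pi / 2)"
      using range by (intro cos_monotone_0_pi_le) auto
    then show False
      using cpos by simp
  qed
  \<comment> \<open>\<open>r\<close> is the speed of the free flight: by tangency its velocity is
    \<open>r\<close> times the unit tangent
    \<open>(- sin theta_exit, cos theta_exit)\<close>.\<close>
  define r where "r = mu * snd u / cos theta_exit"
  have "r > 0"
    using su mu cpos by (simp add: r_def)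
  have shift: "sin (theta_exit + pi / 2) = cos theta_exit" "cos (theta_exit + pi / 2) = - sin theta_exit"
    by (simp_all add: sin_add cos_add)
  have polar: "mu * snd u = r * sin (theta_exit + pi / 2)" "mu * fst u - 1 = r * cos (theta_exit + pi / 2)"
    using tang cpos unfolding shift by (auto simp: r_def field_simps)
  have psi_exit: "sin (psi_of mu x0 T theta_exit) = snd u" "cos (psi_of mu x0 T theta_exit) = fst u"
    using u_psi by (metis snd_conv, metis fst_conv)
  have "atan2 (r * sin (theta_exit + pi / 2)) (r * cos (theta_exit + pi / 2)) = theta_exit + pi / 2"
    using \<open>r > 0\<close> range le by (intro atan2_scaled_angle) auto
  then show ?thesis
    unfolding psi_exit polar by simp
qed

end
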